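(* Let $\ell\ge2$ and let the parameters $q_{ij}$, $i,j=1,\dots,\ell$, satisfy the $C_\ell$ constraints $$\sigma_{ij}=1\ \ (|i-j|>1),\qquad \sigma_{ij}q_{ii}=1\ \ (|i-j|=1,\ i,j=1,\dots,\ell-1),\qquad \sigma_{\ell,\ell-1}q_{\ell\ell}=1,$$ $$q_{11}=\cdots=q_{\ell-1,\ell-1}=:\mathbf{q},\qquad q_{\ell\ell}=\mathbf{q}^2,$$ where $\sigma_{ij}=q_{ij}q_{ji}$, and be otherwise in general position. Define elements of $\mathcal{B}'_q$ by $X^1=\xi_1$, $$X^n=[X^{n-1},\xi_n]_{a_n},\quad a_n=q_{n1}\cdots q_{n,n-2}/q_{n-1,n},\qquad n=2,\dots,\ell,$$ $$X^{\ell+n}=[X^{\ell+n-1},\xi_{\ell-n}]_{b_n},\quad b_n=q_{\ell-n,1}q_{\ell-n,2}\cdots q_{\ell-n,\ell}\;q_{\ell-n,\ell-1}q_{\ell-n,\ell-2}\cdots q_{\ell-n,\ell-n},\qquad n=1,\dots,\ell-1.$$ Then $X^{2\ell-1}$ is a highest root vector for $C_\ell$; that is, it is a nonzero element of $\mathcal{B}'_q$ of degree $2$ in each of $\xi_1,\dots,\xi_{\ell-1}$ and degree $1$ in $\xi_\ell$, and there are complex numbers $c_1,\dots,c_\ell$ such that $[\xi_i,X^{2\ell-1}]_{c_i}=0$ in $\mathcal{B}'_q$ for $i=1,\dots,\ell$.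
   Context: Notation: $[A,B]_a=AB-aBA$ for a complex number $a$. In the formula for $a_n$ the numerator is the product $\prod_{k=1}^{n-2}q_{nk}$ (equal to $1$ for $n=2$); in $b_n$ the second index runs up from $1$ to $\ell$ and then down from $\ell-1$ to $\ell-n$. Let $\mathcal{B}=\bigoplus_n\mathcal{B}(n)$ be the unital associative $\mathbb{C}$-algebra freely generated by $\xi_1,\dots,\xi_\ell$. $\mathcal{B}_q$ is $\mathcal{B}$ equipped with the linear operators $\partial_i$ determined by $\partial_i1=0$, $\partial_i(\xi_jx)=\delta_{ij}x+q_{ij}\xi_j\partial_ix$. A constant is a nonzero $C\in\bigoplus_{n\ge1}\mathcal{B}(n)$ with $\partial_iC=0$ for all $i$; $\mathcal{I}_q$ is the two-sided ideal generated by the constants; $\mathcal{B}'_q=\mathcal{B}_q/\mathcal{I}_q$, with the induced operators $\partial_i$. "Otherwise in general position" means that the parameters satisfy no further relations than those implied by the constraints, so that $\mathcal{I}_q$ is generated by the quantized Serre relations of type $C_\ell$: $\xi_i\xi_j-q_{ji}\xi_j\xi_i$ for $|i-j|>1$; $\frac1{q_{ji}}\xi_i^2\xi_j-(1+q_{ii})\xi_i\xi_j\xi_i+\frac1{q_{ij}}\xi_j\xi_i^2$ for $|i-j|=1$, $(i,j)\neq(\ell-1,\ell)$; and, for $i=\ell-1$, $j=\ell$, $\sum_{m=0}^{3}(-q_{ij})^m q_{ii}^{m(m-1)/2}\binom{3}{m}_{q_{ii}}\xi_i^m\xi_j\xi_i^{3-m}$, with $\binom{k}{m}_q$ the Gaussian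 binomial coefficient. A highest root vector (highest root generator) is an element with the weight of the highest root, which for $C_\ell$ in terms of simple roots is $2r_1+\cdots+2r_{\ell-1}+r_\ell$ ($r_\ell$ the long root), such that there are complex coefficients $c_i$ with $[e_i,E]_{c_i}=0$ for all $i$; the Serre generators $e_i$ are identified with $\xi_i$. *)

theory Defs
  imports "HOL-Library.Poly_Mapping" "HOL-Algebra.QuotRing" Complex_Main
begin

(* Lists under concatenation form the free monoid, so the convolution product on finitely
   supported functions on lists is that of the free algebra; Poly_Mapping then supplies the
   type-class ring structure. *)

instantiation list :: (type) monoid_add
begin

definition zero_list :: "'a list" where
  "zero_list = []"

definition plus_list :: "'a list \<Rightarrow> 'a list \<Rightarrow> 'a list" where
  "plus_list = append"

instance
  by standard (simp_all add: zero_list_def plus_list_def)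

end

type_synonym nc_poly = "nat list \<Rightarrow>\<^sub>0 complex"

definition nc_var :: "nat \<Rightarrow> nc_poly" where
  "nc_var i = Poly_Mapping.single [i] 1"

definition nc_const :: "complex \<Rightarrow> nc_poly" where
  "nc_const c = Poly_Mapping.single [] c"

(* The free algebra on the generators with indices 1, ..., l, inside the free algebra on
   countably many generators. *)

definition free_alg :: "nat \<Rightarrow> nc_poly ring" where
  "free_alg l = \<lparr>carrier = {p. \<forall>w\<in>Poly_Mapping.keys p. set w \<subseteq> {1..l}},
     monoid.mult = (*), one = 1, zero = 0, add = (+)\<rparr>"

primrec qderiv_word :: "(nat \<Rightarrow> nat \<Rightarrow> complex) \<Rightarrow> nat \<Rightarrow> nat list \<Rightarrow> nc_poly" where
  "qderiv_word q i [] = 0"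
| "qderiv_word q i (j # w) =
     (if i = j then Poly_Mapping.single w 1 else 0) + nc_const (q i j) * nc_var j * qderiv_word q i w"

definition qderiv :: "(nat \<Rightarrow> nat \<Rightarrow> complex) \<Rightarrow> nat \<Rightarrow> nc_poly \<Rightarrow> nc_poly" where
  "qderiv q i p = (\<Sum>w\<in>Poly_Mapping.keys p. nc_const (Poly_Mapping.lookup p w) * qderiv_word q i w)"

definition q_constants :: "(nat \<Rightarrow> nat \<Rightarrow> complex) \<Rightarrow> nat \<Rightarrow> nc_poly set" where
  "q_constants q l = {C \<in> carrier (free_alg l).
     C \<noteq> 0 \<and> Poly_Mapping.lookup C [] = 0 \<and> (\<forall>i\<in>{1..l}. qderiv q i C = 0)}"

definition q_ideal :: "(nat \<Rightarrow> nat \<Rightarrow> complex) \<Rightarrow> nat \<Rightarrow> nc_poly set" where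
  "q_ideal q l = genideal (free_alg l) (q_constants q l)"

definition q_quot :: "(nat \<Rightarrow> nat \<Rightarrow> complex) \<Rightarrow> nat \<Rightarrow> nc_poly set ring" where
  "q_quot q l = free_alg l Quot q_ideal q l"

definition q_proj :: "(nat \<Rightarrow> nat \<Rightarrow> complex) \<Rightarrow> nat \<Rightarrow> nc_poly \<Rightarrow> nc_poly set" where
  "q_proj q l p = q_ideal q l +>\<^bsub>free_alg l\<^esub> p"

definition q_gen :: "(nat \<Rightarrow> nat \<Rightarrow> complex) \<Rightarrow> nat \<Rightarrow> nat \<Rightarrow> nc_poly set" where
  "q_gen q l i = q_proj q l (nc_var i)"

(* Multiplication by a complex scalar is written as multiplication by its image in the ring. *)

definition q_bracket ::
    "(nat \<Rightarrow> nat \<Rightarrow> complex) \<Rightarrow> nat \<Rightarrow> complex \<Rightarrow> nc_poly set \<Rightarrow> nc_poly set \<Rightarrow> nc_poly set" where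
  "q_bracket q l a A B =
     A \<otimes>\<^bsub>q_quot q l\<^esub> B \<ominus>\<^bsub>q_quot q l\<^esub>
     q_proj q l (nc_const a) \<otimes>\<^bsub>q_quot q l\<^esub> (B \<otimes>\<^bsub>q_quot q l\<^esub> A)"

definition weight_space :: "nat \<Rightarrow> (nat \<Rightarrow> nat) \<Rightarrow> nc_poly set" where
  "weight_space l d = {p \<in> carrier (free_alg l).
     \<forall>w\<in>Poly_Mapping.keys p. \<forall>i\<in>{1..l}. count_list w i = d i}"

definition q_weight_space ::
    "(nat \<Rightarrow> nat \<Rightarrow> complex) \<Rightarrow> nat \<Rightarrow> (nat \<Rightarrow> nat) \<Rightarrow> nc_poly set set" where
  "q_weight_space q l d = q_proj q l ` weight_space l d"

definition sigma :: "(nat \<Rightarrow> nat \<Rightarrow> complex) \<Rightarrow> nat \<Rightarrow> nat \<Rightarrow> complex" where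
  "sigma q i j = q i j * q j i"

definition C_constraints :: "(nat \<Rightarrow> nat \<Rightarrow> complex) \<Rightarrow> nat \<Rightarrow> bool" where
  "C_constraints q l \<longleftrightarrow>
     (\<forall>i\<in>{1..l}. \<forall>j\<in>{1..l}. \<bar>int i - int j\<bar> > 1 \<longrightarrow> sigma q i j = 1) \<and>
     (\<forall>i\<in>{1..l-1}. \<forall>j\<in>{1..l-1}. \<bar>int i - int j\<bar> = 1 \<longrightarrow> sigma q i j * q i i = 1) \<and>
     sigma q l (l-1) * q l l = 1 \<and>
     (\<forall>i\<in>{1..l-1}. q i i = q 1 1) \<and>
     q l l = (q 1 1)\<^sup>2"

(* Defined by the q-Pascal rule and not as a quotient, hence correct at roots of unity too. *)

fun gauss_binomial :: "complex \<Rightarrow> nat \<Rightarrow> nat \<Rightarrow> complex" where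
  "gauss_binomial t k 0 = 1"
| "gauss_binomial t 0 (Suc m) = 0"
| "gauss_binomial t (Suc k) (Suc m) = gauss_binomial t k m + t ^ Suc m * gauss_binomial t k (Suc m)"

definition C_serre :: "(nat \<Rightarrow> nat \<Rightarrow> complex) \<Rightarrow> nat \<Rightarrow> nat \<Rightarrow> nat \<Rightarrow> nc_poly" where
  "C_serre q l i j =
     (if \<bar>int i - int j\<bar> > 1 then
        nc_var i * nc_var j - nc_const (q j i) * nc_var j * nc_var i
      else if i = l - 1 \<and> j = l then
        (\<Sum>m\<le>3. nc_const ((- q i j) ^ m * q i i ^ (m * (m - 1) div 2) * gauss_binomial (q i i) 3 m)
                 * nc_var i ^ m * nc_var j * nc_var i ^ (3 - m))
      else
        nc_const (1 / q j i) * nc_var i ^ 2 * nc_var j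
        - nc_const (1 + q i i) * nc_var i * nc_var j * nc_var i
        + nc_const (1 / q i j) * nc_var j * nc_var i ^ 2)"

definition C_serre_relations :: "(nat \<Rightarrow> nat \<Rightarrow> complex) \<Rightarrow> nat \<Rightarrow> nc_poly set" where
  "C_serre_relations q l = {C_serre q l i j | i j. i \<in> {1..l} \<and> j \<in> {1..l} \<and> i \<noteq> j}"

(* "No relations among the parameters beyond the constraints" is used in its operative form: the
   ideal generated by all constants is exactly the one generated by the Serre relations.  This
   imposes nothing on parameters that do not influence the constants (such as q 1 2, which may
   be rational). *)

definition C_general_position :: "(nat \<Rightarrow> nat \<Rightarrow> complex) \<Rightarrow> nat \<Rightarrow> bool" where
  "C_general_position q l \<longleftrightarrow> q_ideal q l = genideal (free_alg l) (C_serre_relations q l)"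

definition a_coeff :: "(nat \<Rightarrow> nat \<Rightarrow> complex) \<Rightarrow> nat \<Rightarrow> complex" where
  "a_coeff q n = (\<Prod>k=1..n-2. q n k) / q (n - 1) n"

definition b_coeff :: "(nat \<Rightarrow> nat \<Rightarrow> complex) \<Rightarrow> nat \<Rightarrow> nat \<Rightarrow> complex" where
  "b_coeff q l n = (\<Prod>k=1..l. q (l - n) k) * (\<Prod>k=l-n..l-1. q (l - n) k)"

(* Only the indices 1, ..., 2 * l - 1 are meaningful. *)

primrec X_elem :: "(nat \<Rightarrow> nat \<Rightarrow> complex) \<Rightarrow> nat \<Rightarrow> nat \<Rightarrow> nc_poly set" where
  "X_elem q l 0 = \<zero>\<^bsub>q_quot q l\<^esub>"
| "X_elem q l (Suc m) =
     (if m = 0 then q_gen q l 1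
      else if Suc m \<le> l then q_bracket q l (a_coeff q (Suc m)) (X_elem q l m) (q_gen q l (Suc m))
      else q_bracket q l (b_coeff q l (Suc m - l)) (X_elem q l m) (q_gen q l (l - (Suc m - l))))"

definition C_highest_root :: "nat \<Rightarrow> nat \<Rightarrow> nat" where
  "C_highest_root l i = (if i = l then 1 else 2)"

definition C_highest_root_vector ::
    "(nat \<Rightarrow> nat \<Rightarrow> complex) \<Rightarrow> nat \<Rightarrow> nc_poly set \<Rightarrow> bool" where
  "C_highest_root_vector q l E \<longleftrightarrow>
     E \<in> q_weight_space q l (C_highest_root l) \<and> E \<noteq> \<zero>\<^bsub>q_quot q l\<^esub> \<and>
     (\<exists>c :: nat \<Rightarrow> complex. \<forall>i\<in>{1..l}. q_bracket q l (c i) (q_gen q l i) E = \<zero>\<^bsub>q_quot q l\<^esub>)"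


lemma nc_poly_induct [case_names single add]:
  fixes p :: nc_poly
  assumes single: "\<And>w c. P (Poly_Mapping.single w c)" and add: "\<And>p r. P p \<Longrightarrow> P r \<Longrightarrow> P (p + r)"
  shows "P p"
proof (induction p rule: update_induct)
  case const
  then show ?case using single[of "[]" 0] by simp
next
  case (update f a b)
  have "Poly_Mapping.update a b f = f + Poly_Mapping.single a b"
    using update.hyps
    by (intro poly_mapping_eqI) (auto simp: lookup_update lookup_add lookup_single in_keys_iff when_def)
  then show ?case using add[OF update.IH single[of a b]] by simp
qed

lemma nc_one: "(1 :: nc_poly) = Poly_Mapping.single [] 1"
  by (metis single_one zero_list_def)

lemma keys_mult_append:
  fixes p r :: nc_poly
  assumes "w \<in> Poly_Mapping.keys (p * r)"
  obtains u v where "u \<in> Poly_Mapping.keys p" "v \<in> Poly_Mapping.keys r" "w = u @ v"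
  using keys_mult[of p r] assms by (auto simp: plus_list_def)

lemma ring_free_alg: "ring (free_alg l)"
proof (rule ringI)
  show "abelian_group (free_alg l)"
  proof (rule abelian_groupI)
    fix x assume "x \<in> carrier (free_alg l)"
    then show "\<exists>y\<in>carrier (free_alg l). y \<oplus>\<^bsub>free_alg l\<^esub> x = \<zero>\<^bsub>free_alg l\<^esub>"
      by (intro bexI[of _ "- x"]) (auto simp: free_alg_def in_keys_iff)
  qed (auto simp: free_alg_def add_ac dest: subsetD[OF Poly_Mapping.keys_add])
  show "Group.monoid (free_alg l)"
  proof (rule monoidI)
    fix x y assume "x \<in> carrier (free_alg l)" "y \<in> carrier (free_alg l)"
    then have x: "\<And>w. w \<in> Poly_Mapping.keys x \<Longrightarrow> set w \<subseteq> {1..l}"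
      and y: "\<And>w. w \<in> Poly_Mapping.keys y \<Longrightarrow> set w \<subseteq> {1..l}"
      by (auto simp: free_alg_def)
    have "set w \<subseteq> {1..l}" if "w \<in> Poly_Mapping.keys (x * y)" for w
    proof -
      from that obtain u v where "u \<in> Poly_Mapping.keys x" "v \<in> Poly_Mapping.keys y" "w = u @ v"
        by (rule keys_mult_append)
      then show ?thesis using x[of u] y[of v] by simp
    qed
    then show "x \<otimes>\<^bsub>free_alg l\<^esub> y \<in> carrier (free_alg l)"
      by (simp add: free_alg_def)
  next
    show "\<one>\<^bsub>free_alg l\<^esub> \<in> carrier (free_alg l)"
      by (simp add: free_alg_def nc_one)
  qed (simp_all add: free_alg_def mult.assoc)
qed (auto simp: free_alg_def algebra_simps)

lemma qderiv_one [simp]: "qderiv q i 1 = 0"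
  by (simp add: qderiv_def nc_one)

lemma qderiv_superset:
  assumes "finite S" "Poly_Mapping.keys p \<subseteq> S"
  shows "qderiv q i p = (\<Sum>w\<in>S. nc_const (Poly_Mapping.lookup p w) * qderiv_word q i w)"
  unfolding qderiv_def
  by (rule sum.mono_neutral_left) (use assms in \<open>auto simp: in_keys_iff nc_const_def\<close>)

lemma qderiv_add: "qderiv q i (p + r) = qderiv q i p + qderiv q i r"
proof -
  let ?S = "Poly_Mapping.keys p \<union> Poly_Mapping.keys r"
  have "Poly_Mapping.keys (p + r) \<subseteq> ?S" by (rule Poly_Mapping.keys_add)
  then show ?thesis
    by (simp add: qderiv_superset[of ?S] nc_const_def lookup_add single_add
        distrib_right sum.distrib)
qed

lemma qderiv_single: "qderiv q i (Poly_Mapping.single w c) = nc_const c * qderiv_word q i w"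
  by (cases "c = 0") (simp_all add: qderiv_def nc_const_def)

lemma nc_const_commute: "nc_const c * p = p * nc_const c"
proof (induction p rule: nc_poly_induct)
  case (single k v)
  then show ?case by (simp add: nc_const_def mult_single plus_list_def mult.commute)
qed (simp add: algebra_simps)

lemma nc_const_mult: "nc_const (c * d) = nc_const c * nc_const d"
  by (simp add: nc_const_def mult_single plus_list_def)

lemma qderiv_scale: "qderiv q i (nc_const c * p) = nc_const c * qderiv q i p"
proof (induction p rule: nc_poly_induct)
  case (single k v)
  have "nc_const c * Poly_Mapping.single k v = Poly_Mapping.single k (c * v)"
    by (simp add: nc_const_def mult_single plus_list_def)
  then show ?case by (simp add: qderiv_single nc_const_mult mult.assoc)
qed (simp add: algebra_simps qderiv_add)

lemma qderiv_var_mult: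
  "qderiv q i (nc_var j * p) = (if i = j then p else 0) + nc_const (q i j) * nc_var j * qderiv q i p"
proof (induction p rule: nc_poly_induct)
  case (single k v)
  have 1: "nc_var j * Poly_Mapping.single k v = Poly_Mapping.single (j # k) v"
    and 2: "nc_const v * Poly_Mapping.single k 1 = Poly_Mapping.single k v"
    by (simp_all add: nc_var_def nc_const_def mult_single plus_list_def)
  have 3: "nc_const v * (nc_const (q i j) * nc_var j * r)
      = nc_const (q i j) * nc_var j * (nc_const v * r)" for r
    by (metis mult.assoc nc_const_commute)
  show ?case
    unfolding 1 qderiv_single by (simp add: distrib_left 2 3)
qed (simp add: algebra_simps qderiv_add)

end

theory Submission
  imports Defs
begin

text \<open>
Write $D_c\,x = \xi_i x - c\,x\xi_i$ for the q-commutator with a fixed generator. The letters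
bracketed on successively are $1, \ldots, l, l-1, \ldots, 1$. The heart of the proof is the lemma
\<open>root_poly_commute\<close>: modulo the ideal, every generator q-commutes with $X^m$, with an explicit
factor $\kappa(m,i)$, except the generator that is bracketed on next. For that next letter $j$ the
prescribed coefficient $a_n$ or $b_n$ is exactly $1/\kappa(m,j)$ (\<open>a_coeff_eq\<close>, \<open>b_coeff_eq\<close>), so
that $X^{m+1}$ is a multiple of $D_{\kappa(m,j)} X^m$. After the last step no letter is next, and all
generators q-commute with $X^{2l-1}$.

The tools are the twisted Leibniz rule $D_{cd}(xy) = D_c(x)\,y + c\,x\,D_d(y)$ and the observation that
a Serre relation says that a product of two or three operators $D$ kills a generator. In the induction
on $m$, a generator far from the new letter $j$ is harmless. Away from the
turning point the letter $j$ itself q-commutes with $X^{m+1}$ because of its Serre relation with the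
preceding letter. The delicate generator is the letter
$p$ used just before $j$: there a product of operators $D$ is applied to both sides of a relation
$U\xi_j = c\,\xi_j U$ and evaluated by the Leibniz rule in two ways; the comparison yields
$(1+q_{pp})$ times the relation wanted (\<open>serre_square_exchange\<close>). At the turning point, where the
letters run $l-1, l, l-1$, the same comparison with the cubic relation gives a factor
$1+\mathbf{q}+\mathbf{q}^2$ (\<open>serre_cube_exchange\<close>). General position enters by making these
factors invertible: if one of them vanished, $\xi_p^2$ or $\xi_1^3$ would be a constant, but
monomials in a single letter do not lie in the ideal of the Serre relations. A similar argument in
degree two shows $q_{jj} \neq 1$, which the last step needs.

For $X^{2l-1} \neq 0$: the ideal of constants is stable under the twisted derivations
(\<open>qderiv_q_ideal\<close>), and modulo it the derivation for the last letter of $X^m$ takes $X^m$ to a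
nonzero multiple of $X^{m-1}$ (\<open>qderiv_root_poly\<close>). Descending through all letters leads to a
nonzero scalar, which is not in the ideal.
\<close>


section \<open>Scalars and q-commutators in the free algebra\<close>

definition scale :: "complex \<Rightarrow> nc_poly \<Rightarrow> nc_poly" (infixr "*\<^sub>C" 75) where
  "c *\<^sub>C p = nc_const c * p"

lemma scale_mult_left [simp]: "(c *\<^sub>C p) * r = c *\<^sub>C (p * r)"
  by (simp add: scale_def mult.assoc)

lemma scale_mult_right [simp]: "p * (c *\<^sub>C r) = c *\<^sub>C (p * r)"
  by (metis scale_def mult.assoc nc_const_commute)

lemma scale_scale [simp]: "c *\<^sub>C d *\<^sub>C p = (c * d) *\<^sub>C p"
  by (simp add: scale_def nc_const_mult mult.assoc)

lemma scale_zero [simp]: "c *\<^sub>C 0 = 0"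
  by (simp add: scale_def)

lemma zero_scale [simp]: "0 *\<^sub>C p = 0"
  by (simp add: scale_def nc_const_def)

lemma one_scale [simp]: "1 *\<^sub>C p = p"
  by (simp add: scale_def nc_const_def flip: nc_one)

lemma scale_add_right: "c *\<^sub>C (p + r) = c *\<^sub>C p + c *\<^sub>C r"
  by (simp add: scale_def distrib_left)

lemma scale_diff_right: "c *\<^sub>C (p - r) = c *\<^sub>C p - c *\<^sub>C r"
  by (simp add: scale_def right_diff_distrib)

lemma scale_add_left: "(c + d) *\<^sub>C p = c *\<^sub>C p + d *\<^sub>C p"
  by (simp add: scale_def nc_const_def single_add distrib_right)

lemma scale_diff_left: "(c - d) *\<^sub>C p = c *\<^sub>C p - d *\<^sub>C p"
  by (simp add: scale_def nc_const_def single_diff left_diff_distrib)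

lemma scale_minus_left: "(- c) *\<^sub>C p = - (c *\<^sub>C p)"
  using scale_diff_left[of 0 c p] by simp

lemma scale_minus_right: "c *\<^sub>C (- p) = - (c *\<^sub>C p)"
  using scale_diff_right[of c 0 p] by simp

lemma lookup_scale: "Poly_Mapping.lookup (c *\<^sub>C p) w = c * Poly_Mapping.lookup p w"
proof (induction p rule: nc_poly_induct)
  case (single v d)
  then show ?case
    by (simp add: scale_def nc_const_def mult_single plus_list_def lookup_single when_def)
qed (simp add: scale_add_right lookup_add distrib_left)

lemmas scale_simps = scale_add_right scale_diff_right scale_add_left scale_diff_left
  scale_minus_left scale_minus_right

lemma scale_cancel_common: "(a + b) - w *\<^sub>C (c + d) - (b - w *\<^sub>C d) = a - w *\<^sub>C c"
  by (simp add: scale_add_right)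

text \<open>The q-commutator as an operator on \<open>x\<close>. The scalar \<open>c\<close> is explicit and not computed from the weights
of \<open>f\<close> and \<open>x\<close>, so that no grading has to be carried along.\<close>

definition qad :: "nc_poly \<Rightarrow> complex \<Rightarrow> nc_poly \<Rightarrow> nc_poly" where
  "qad f c x = f * x - c *\<^sub>C (x * f)"

lemma qad_add: "qad f c (x + y) = qad f c x + qad f c y"
  by (simp add: qad_def algebra_simps scale_simps)

lemma qad_diff: "qad f c (x - y) = qad f c x - qad f c y"
  by (simp add: qad_def algebra_simps scale_simps)

lemma qad_scale: "qad f c (a *\<^sub>C x) = a *\<^sub>C qad f c x"
  by (simp add: qad_def algebra_simps scale_simps)

text \<open>The twisted Leibniz rule. The scalar may be split in any way as \<open>c * d\<close>, which is what allows the
same operator to be evaluated differently on \<open>U * g\<close> and on \<open>g * U\<close>.\<close>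

lemma qad_mult: "qad f (c * d) (x * y) = qad f c x * y + c *\<^sub>C (x * qad f d y)"
  by (simp add: qad_def algebra_simps scale_simps)

section \<open>Calculus modulo an ideal\<close>

locale free_alg_ideal =
  fixes l :: nat and I :: "nc_poly set"
  assumes ideal: "ideal I (free_alg l)"
begin

abbreviation "A \<equiv> carrier (free_alg l)"

lemma A_add [intro]: "x \<in> A \<Longrightarrow> y \<in> A \<Longrightarrow> x + y \<in> A"
  using ring.ring_simprules(1)[OF ring_free_alg, of x l y] by (simp add: free_alg_def)

lemma A_mult [intro]: "x \<in> A \<Longrightarrow> y \<in> A \<Longrightarrow> x * y \<in> A"
  using ring.ring_simprules(5)[OF ring_free_alg, of x l y] by (simp add: free_alg_def)

lemma A_const [intro]: "nc_const c \<in> A"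
  by (simp add: free_alg_def nc_const_def)

lemma A_scale [intro]: "x \<in> A \<Longrightarrow> c *\<^sub>C x \<in> A"
  by (auto simp: scale_def)

lemma A_diff [intro]: "x \<in> A \<Longrightarrow> y \<in> A \<Longrightarrow> x - y \<in> A"
  using A_add[of x "(-1) *\<^sub>C y"] A_scale[of y "-1"] by (simp add: scale_minus_left)

lemma A_var [intro]: "i \<in> {1..l} \<Longrightarrow> nc_var i \<in> A"
  by (simp add: free_alg_def nc_var_def)

lemma A_qad [intro]: "f \<in> A \<Longrightarrow> x \<in> A \<Longrightarrow> qad f c x \<in> A"
  unfolding qad_def by (intro A_diff A_scale A_mult)

lemma I_subset: "x \<in> I \<Longrightarrow> x \<in> A"
  by (rule ideal.Icarr[OF ideal])

lemma I_zero [simp]: "0 \<in> I"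
  using additive_subgroup.zero_closed[OF ideal.axioms(1)[OF ideal]] by (simp add: free_alg_def)

lemma I_add: "x \<in> I \<Longrightarrow> y \<in> I \<Longrightarrow> x + y \<in> I"
  using additive_subgroup.a_closed[OF ideal.axioms(1)[OF ideal], of x y] by (simp add: free_alg_def)

lemma I_lmult: "a \<in> A \<Longrightarrow> x \<in> I \<Longrightarrow> a * x \<in> I"
  using ideal.I_l_closed[OF ideal, of x a] by (simp add: free_alg_def)

lemma I_rmult: "a \<in> A \<Longrightarrow> x \<in> I \<Longrightarrow> x * a \<in> I"
  using ideal.I_r_closed[OF ideal, of x a] by (simp add: free_alg_def)

lemma I_scale: "x \<in> I \<Longrightarrow> c *\<^sub>C x \<in> I"
  unfolding scale_def by (rule I_lmult[OF A_const])

lemma I_diff: "x \<in> I \<Longrightarrow> y \<in> I \<Longrightarrow> x - y \<in> I"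
  using I_add[of x "(-1) *\<^sub>C y"] I_scale[of y "-1"] by (auto simp: scale_minus_left)

lemma I_unscale: "c *\<^sub>C x \<in> I \<Longrightarrow> c \<noteq> 0 \<Longrightarrow> x \<in> I"
  using I_scale[of "c *\<^sub>C x" "1 / c"] by simp

lemma I_qad: "f \<in> A \<Longrightarrow> x \<in> I \<Longrightarrow> qad f c x \<in> I"
  unfolding qad_def by (rule I_diff[OF I_lmult I_scale[OF I_rmult]])

lemmas I_intros = I_add I_diff I_scale I_lmult I_rmult I_qad

lemma qad_mult_in_ideal:
  assumes "x \<in> A" "y \<in> A" "qad f c x \<in> I" "qad f d y \<in> I"
  shows "qad f (c * d) (x * y) \<in> I"
  unfolding qad_mult
  by (rule I_add[OF I_rmult[OF assms(2,3)] I_scale[OF I_lmult[OF assms(1,4)]]])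

lemma qad_bracket_in_ideal:
  assumes "x \<in> A" "y \<in> A" "qad f c x \<in> I" "qad f d y \<in> I"
  shows "qad f (c * d) (x * y - b *\<^sub>C (y * x)) \<in> I"
  unfolding qad_diff qad_scale
  using qad_mult_in_ideal[OF assms] qad_mult_in_ideal[OF assms(2,1,4,3)]
  by (intro I_diff I_scale) (simp_all only: mult.commute[of d c])

text \<open>If \<open>f\<close> q-commutes with \<open>U\<close>, then each \<open>qad f\<close> passes through \<open>U\<close> and acts on \<open>g\<close> alone, so a
quadratic Serre relation for \<open>g\<close> is inherited by every bracket of \<open>U\<close> and \<open>g\<close>.\<close>

lemma serre_square_bracket:
  assumes A: "f \<in> A" "U \<in> A" "g \<in> A"
    and U: "qad f u U \<in> I"
    and g: "qad f e (qad f d g) \<in> I"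
  shows "qad f (u * e) (qad f (u * d) (U * g - b *\<^sub>C (g * U))) \<in> I"
proof -
  have gU: "qad f (u * c) (g' * U) = qad f c g' * U + c *\<^sub>C (g' * qad f u U)" for c g'
    using qad_mult[of f c u g' U] by (simp add: mult.commute)
  have 1: "qad f (u * e) (qad f (u * d) (U * g)) \<in> I"
    unfolding qad_mult[of f u d U g] qad_add qad_scale qad_mult[of f u e U "qad f d g"]
    using assms by (simp add: I_intros A_qad)
  have 2: "qad f (u * e) (qad f (u * d) (g * U)) \<in> I"
    unfolding gU qad_add qad_scale
    using assms by (simp add: I_intros A_qad)
  show ?thesis
    unfolding qad_diff qad_scale by (intro I_diff I_scale 1 2)
qed

text \<open>The letter \<open>f\<close> was bracketed onto \<open>U\<close> to give \<open>Y\<close>, and \<open>g\<close> is bracketed on next. Two operators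
\<open>qad f\<close> are applied to \<open>g * U = w * U * g\<close>. On \<open>U * g\<close> as well as on \<open>g * U\<close> only the mixed terms
survive, because \<open>f\<close> annihilates \<open>U\<close> and \<open>g\<close> after two steps; both mixed terms carry the factor
\<open>1 + t\<close>. Dividing by it shows that \<open>Y\<close> and \<open>h = qad f d g\<close> q-commute, and \<open>qad f\<close> applied to the
bracket of \<open>Y\<close> and \<open>g\<close> is a multiple of that q-commutator. The coefficient \<open>t * d / w\<close> is forced.\<close>

lemma serre_square_exchange:
  assumes A: "f \<in> A" "g \<in> A" "U \<in> A"
    and nz: "u \<noteq> 0" "w \<noteq> 0" "1 + t \<noteq> 0"
    and Y: "Y = U * f - (1 / u) *\<^sub>C (f * U)"
    and fY: "qad f (u * t) Y \<in> I"
    and gU: "qad g w U \<in> I"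
    and g: "qad f (d * t) (qad f d g) \<in> I"
  shows "qad f (u * t * d) (Y * g - (t * d / w) *\<^sub>C (g * Y)) \<in> I"
proof -
  define h where "h = qad f d g"
  have YA: "Y \<in> A" and hA: "h \<in> A" 
    using A Y h_def by auto
  have DU: "qad f u U = (- u) *\<^sub>C Y"
    using nz by (simp add: Y qad_def scale_simps)
  have 1: "qad f (u * t * d) (qad f (u * d) (U * g)) = (- u * u * (1 + t)) *\<^sub>C (Y * h)
      + ((- u) *\<^sub>C (qad f (u * t) Y * g) + (u * u) *\<^sub>C (U * qad f (d * t) h))"
  proof -
    have a: "qad f (u * d) (U * g) = (- u) *\<^sub>C (Y * g) + u *\<^sub>C (U * h)"
      by (simp add: qad_mult DU h_def)
    have b: "qad f (u * t * d) (Y * g) = qad f (u * t) Y * g + (u * t) *\<^sub>C (Y * h)"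
      by (simp add: qad_mult h_def)
    have c: "qad f (u * t * d) (U * h) = (- u) *\<^sub>C (Y * h) + u *\<^sub>C (U * qad f (d * t) h)"
      using qad_mult[of f u "d * t" U h] by (simp add: DU ac_simps)
    show ?thesis
      unfolding a qad_add qad_scale b c by (simp add: scale_simps algebra_simps)
  qed
  have 2: "qad f (u * t * d) (qad f (u * d) (g * U)) = (- u * d * (1 + t)) *\<^sub>C (h * Y)
      + ((- u * d * d) *\<^sub>C (g * qad f (u * t) Y) + qad f (d * t) h * U)"
  proof -
    have a: "qad f (u * d) (g * U) = h * U + (- u * d) *\<^sub>C (g * Y)"
      using qad_mult[of f d u g U] by (simp add: DU h_def ac_simps)
    have b: "qad f (u * t * d) (g * Y) = h * Y + d *\<^sub>C (g * qad f (u * t) Y)"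
      using qad_mult[of f d "u * t" g Y] by (simp add: h_def ac_simps)
    have c: "qad f (u * t * d) (h * U) = qad f (d * t) h * U + (- u * d * t) *\<^sub>C (h * Y)"
      using qad_mult[of f "d * t" u h U] by (simp add: DU ac_simps)
    show ?thesis
      unfolding a qad_add qad_scale b c by (simp add: scale_simps algebra_simps)
  qed
  have "qad f (u * t * d) (qad f (u * d) (qad g w U)) \<in> I"
    using A(1) gU by (simp add: I_qad)
  then have "(- u * d * (1 + t)) *\<^sub>C (h * Y)
      + ((- u * d * d) *\<^sub>C (g * qad f (u * t) Y) + qad f (d * t) h * U)
     - w *\<^sub>C ((- u * u * (1 + t)) *\<^sub>C (Y * h)
      + ((- u) *\<^sub>C (qad f (u * t) Y * g) + (u * u) *\<^sub>C (U * qad f (d * t) h))) \<in> I" (is "?E \<in> I")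
    by (simp only: qad_def[of g] qad_diff qad_scale 1 2)
  moreover have "(- u * d * d) *\<^sub>C (g * qad f (u * t) Y) + qad f (d * t) h * U
     - w *\<^sub>C ((- u) *\<^sub>C (qad f (u * t) Y * g) + (u * u) *\<^sub>C (U * qad f (d * t) h)) \<in> I" (is "?F \<in> I")
    using A fY g YA by (simp add: h_def I_intros)
  ultimately have "?E - ?F \<in> I"
    by (rule I_diff)
  also have "?E - ?F = (w * (u * u * (1 + t))) *\<^sub>C (Y * h) - (u * d * (1 + t)) *\<^sub>C (h * Y)"
    unfolding scale_cancel_common by (simp add: scale_minus_left scale_minus_right)
  also have "\<dots> = (u * (1 + t) * w) *\<^sub>C (u *\<^sub>C (Y * h) - (d / w) *\<^sub>C (h * Y))"
    using nz by (simp add: scale_diff_right mult_ac)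
  finally have Yh: "u *\<^sub>C (Y * h) - (d / w) *\<^sub>C (h * Y) \<in> I"
    by (rule I_unscale) (use nz in auto)
  have "qad f (u * t * d) (Y * g - (t * d / w) *\<^sub>C (g * Y))
     = t *\<^sub>C (u *\<^sub>C (Y * h) - (d / w) *\<^sub>C (h * Y))
       + qad f (u * t) Y * g - (t * d / w) *\<^sub>C (d *\<^sub>C (g * qad f (u * t) Y))"
    using qad_mult[of f "u * t" d Y g] qad_mult[of f d "u * t" g Y]
    by (simp add: qad_diff qad_scale h_def scale_simps algebra_simps)
  also have "\<dots> \<in> I"
    by (intro I_add I_diff I_scale I_lmult I_rmult Yh fY A YA)
  finally show ?thesis .
qed

text \<open>The analogue for the letters \<open>l - 1, l, l - 1\<close>: the Serre relation of \<open>g\<close> is cubic, so three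
operators are applied to \<open>g * U = w * U * g\<close>. The surviving terms contain \<open>Y\<close> and
\<open>k = qad f (d * t) (qad f d g)\<close>, and their common factor is the q-number \<open>1 + t + t\<^sup>2\<close>.\<close>

lemma serre_cube_exchange:
  assumes A: "f \<in> A" "g \<in> A" "U \<in> A"
    and nz: "u \<noteq> 0" "w \<noteq> 0" "1 + t + t\<^sup>2 \<noteq> 0"
    and Y: "Y = U * f - (1 / u) *\<^sub>C (f * U)"
    and fY: "qad f (u * t) Y \<in> I"
    and gU: "qad g w U \<in> I"
    and g: "qad f (d * t\<^sup>2) (qad f (d * t) (qad f d g)) \<in> I"
  shows "qad f (u * t\<^sup>2 * d) (qad f (u * t * d) (Y * g - (t\<^sup>2 * d / w) *\<^sub>C (g * Y))) \<in> I"
proof -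
  define h where "h = qad f d g"
  define k where "k = qad f (d * t) h"
  define y where "y = qad f (u * t) Y"
  define z where "z = qad f (d * t\<^sup>2) k"
  have YA: "Y \<in> A" and hA: "h \<in> A" and kA: "k \<in> A"
    using A Y h_def k_def by auto
  have yI: "y \<in> I" and zI: "z \<in> I"
    using fY g by (auto simp: y_def z_def k_def h_def)
  have DU: "qad f u U = (- u) *\<^sub>C Y"
    using nz by (simp add: Y qad_def scale_simps)
  \<comment> \<open>each scalar \<open>u * t ^ n * d\<close> is split so that the factor for \<open>U\<close> is \<open>u\<close> and the one for \<open>Y\<close> is
    \<open>u * t\<close>; the second factor is then the one at which \<open>g\<close>, \<open>h\<close>, \<open>k\<close> are taken to the next\<close>
  have Ug: "qad f (u * d) (U * g) = (- u) *\<^sub>C (Y * g) + u *\<^sub>C (U * h)"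
    by (simp add: qad_mult DU h_def)
  have Yg: "qad f (u * t * d) (Y * g) = y * g + (u * t) *\<^sub>C (Y * h)"
    by (simp add: qad_mult h_def y_def)
  have Uh: "qad f (u * t * d) (U * h) = (- u) *\<^sub>C (Y * h) + u *\<^sub>C (U * k)"
    using qad_mult[of f u "d * t" U h] by (simp add: DU ac_simps k_def)
  have Yh: "qad f (u * t\<^sup>2 * d) (Y * h) = y * h + (u * t) *\<^sub>C (Y * k)"
    using qad_mult[of f "u * t" "d * t" Y h] by (simp add: k_def y_def ac_simps power2_eq_square)
  have Uk: "qad f (u * t\<^sup>2 * d) (U * k) = (- u) *\<^sub>C (Y * k) + u *\<^sub>C (U * z)"
    using qad_mult[of f u "d * t\<^sup>2" U k] by (simp add: DU ac_simps z_def)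
  have gU': "qad f (u * d) (g * U) = h * U + (- u * d) *\<^sub>C (g * Y)"
    using qad_mult[of f d u g U] by (simp add: DU h_def ac_simps)
  have gY: "qad f (u * t * d) (g * Y) = h * Y + d *\<^sub>C (g * y)"
    using qad_mult[of f d "u * t" g Y] by (simp add: h_def y_def ac_simps)
  have hU: "qad f (u * t * d) (h * U) = k * U + (- u * d * t) *\<^sub>C (h * Y)"
    using qad_mult[of f "d * t" u h U] by (simp add: DU ac_simps k_def)
  have hY: "qad f (u * t\<^sup>2 * d) (h * Y) = k * Y + (d * t) *\<^sub>C (h * y)"
    using qad_mult[of f "d * t" "u * t" h Y] by (simp add: k_def y_def ac_simps power2_eq_square)
  have kU: "qad f (u * t\<^sup>2 * d) (k * U) = z * U + (- u * d * t\<^sup>2) *\<^sub>C (k * Y)"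
    using qad_mult[of f "d * t\<^sup>2" u k U] by (simp add: DU ac_simps z_def)
  define yg where "yg = qad f (u * t\<^sup>2 * d) (y * g)"
  define gy where "gy = qad f (u * t\<^sup>2 * d) (g * y)"
  have junk: "yg \<in> I" "gy \<in> I" "y * h \<in> I" "h * y \<in> I" "z * U \<in> I" "U * z \<in> I"
    using A yI zI hA by (auto simp: yg_def gy_def intro: I_qad I_lmult I_rmult)
  have 1: "qad f (u * t\<^sup>2 * d) (qad f (u * t * d) (qad f (u * d) (U * g)))
     = (- (u ^ 3) * (1 + t + t\<^sup>2)) *\<^sub>C (Y * k)
       + ((- u) *\<^sub>C yg + (- (u\<^sup>2) * (1 + t)) *\<^sub>C (y * h) + (u ^ 3) *\<^sub>C (U * z))"
    unfolding Ug qad_add qad_scale Yg Uh Yh Uk yg_def[symmetric]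
    by (simp add: scale_simps algebra_simps power2_eq_square power3_eq_cube)
  have 2: "qad f (u * t\<^sup>2 * d) (qad f (u * t * d) (qad f (u * d) (g * U)))
     = (- u * d * (1 + t + t\<^sup>2)) *\<^sub>C (k * Y)
       + ((- u * d\<^sup>2) *\<^sub>C gy + (- u * d\<^sup>2 * t * (1 + t)) *\<^sub>C (h * y) + z * U)"
    unfolding gU' qad_add qad_scale gY hU hY kU gy_def[symmetric]
    by (simp add: scale_simps algebra_simps power2_eq_square power3_eq_cube)
  have "qad f (u * t\<^sup>2 * d) (qad f (u * t * d) (qad f (u * d) (qad g w U))) \<in> I"
    using A(1) gU by (simp add: I_qad)
  then have "((- u * d * (1 + t + t\<^sup>2)) *\<^sub>C (k * Y)
       + ((- u * d\<^sup>2) *\<^sub>C gy + (- u * d\<^sup>2 * t * (1 + t)) *\<^sub>C (h * y) + z * U))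
      - w *\<^sub>C ((- (u ^ 3) * (1 + t + t\<^sup>2)) *\<^sub>C (Y * k)
       + ((- u) *\<^sub>C yg + (- (u\<^sup>2) * (1 + t)) *\<^sub>C (y * h) + (u ^ 3) *\<^sub>C (U * z))) \<in> I" (is "?E \<in> I")
    by (simp only: qad_def[of g] qad_diff qad_scale 1 2)
  moreover have "((- u * d\<^sup>2) *\<^sub>C gy + (- u * d\<^sup>2 * t * (1 + t)) *\<^sub>C (h * y) + z * U)
      - w *\<^sub>C ((- u) *\<^sub>C yg + (- (u\<^sup>2) * (1 + t)) *\<^sub>C (y * h) + (u ^ 3) *\<^sub>C (U * z)) \<in> I"
      (is "?F \<in> I")
    by (intro junk I_add I_diff I_scale)
  ultimately have "?E - ?F \<in> I"
    by (rule I_diff)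
  also have "?E - ?F = (w * (u ^ 3 * (1 + t + t\<^sup>2))) *\<^sub>C (Y * k)
      - (u * d * (1 + t + t\<^sup>2)) *\<^sub>C (k * Y)"
    unfolding scale_cancel_common by (simp add: scale_minus_left scale_minus_right)
  also have "\<dots> = (u * (1 + t + t\<^sup>2) * w) *\<^sub>C (u\<^sup>2 *\<^sub>C (Y * k) - (d / w) *\<^sub>C (k * Y))"
    using nz by (simp add: scale_diff_right mult_ac power2_eq_square power3_eq_cube)
  finally have Yk: "u\<^sup>2 *\<^sub>C (Y * k) - (d / w) *\<^sub>C (k * Y) \<in> I"
    by (rule I_unscale) (use nz in auto)
  have "qad f (u * t\<^sup>2 * d) (qad f (u * t * d) (Y * g - (t\<^sup>2 * d / w) *\<^sub>C (g * Y)))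
     = t\<^sup>2 *\<^sub>C (u\<^sup>2 *\<^sub>C (Y * k) - (d / w) *\<^sub>C (k * Y))
       + yg + (u * t) *\<^sub>C (y * h) - (t\<^sup>2 * d / w) *\<^sub>C (d *\<^sub>C gy + (d * t) *\<^sub>C (h * y))"
    unfolding qad_add qad_diff qad_scale Yg Yh gY hY yg_def gy_def
    by (simp add: scale_simps algebra_simps power2_eq_square)
  also have "\<dots> \<in> I"
    by (intro junk Yk I_add I_diff I_scale)
  finally show ?thesis .
qed

end


section \<open>Twisted derivations and the ideal of constants\<close>

text \<open>The grading automorphism by which \<open>qderiv q i\<close> fails to be a derivation: it multiplies the
generator \<open>j\<close> by \<open>q i j\<close>.\<close>

definition qtwist_word :: "(nat \<Rightarrow> nat \<Rightarrow> complex) \<Rightarrow> nat \<Rightarrow> nat list \<Rightarrow> complex" where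
  "qtwist_word q i w = prod_list (map (q i) w)"

definition qtwist :: "(nat \<Rightarrow> nat \<Rightarrow> complex) \<Rightarrow> nat \<Rightarrow> nc_poly \<Rightarrow> nc_poly" where
  "qtwist q i p = (\<Sum>w\<in>Poly_Mapping.keys p.
     Poly_Mapping.single w (qtwist_word q i w * Poly_Mapping.lookup p w))"

lemma lookup_qtwist:
  "Poly_Mapping.lookup (qtwist q i p) w = qtwist_word q i w * Poly_Mapping.lookup p w"
proof -
  have "Poly_Mapping.lookup (qtwist q i p) w
      = (\<Sum>v\<in>Poly_Mapping.keys p. if v = w then qtwist_word q i v * Poly_Mapping.lookup p v else 0)"
    by (simp add: qtwist_def lookup_sum lookup_single when_def)
  then show ?thesis
    by (simp add: in_keys_iff)
qed

lemma qtwist_add: "qtwist q i (p + r) = qtwist q i p + qtwist q i r"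
  by (intro poly_mapping_eqI) (simp add: lookup_qtwist lookup_add distrib_left)

lemma qtwist_single:
  "qtwist q i (Poly_Mapping.single w c) = Poly_Mapping.single w (qtwist_word q i w * c)"
  by (intro poly_mapping_eqI) (simp add: lookup_qtwist lookup_single when_def)

lemma qtwist_mult: "qtwist q i (p * r) = qtwist q i p * qtwist q i r"
proof (induction p rule: nc_poly_induct)
  case (single w c)
  show ?case
  proof (induction r rule: nc_poly_induct)
    case (single v d)
    show ?case
      by (simp add: mult_single qtwist_single qtwist_word_def plus_list_def mult_ac)
  qed (simp add: qtwist_add distrib_left)
qed (simp add: qtwist_add distrib_right)

lemma qtwist_var: "qtwist q i (nc_var j) = q i j *\<^sub>C nc_var j"
  by (simp add: nc_var_def qtwist_single qtwist_word_def scale_def nc_const_def mult_single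
      plus_list_def)

lemma qtwist_const: "qtwist q i (nc_const c) = nc_const c"
  by (simp add: nc_const_def qtwist_single qtwist_word_def)

lemma qtwist_scale: "qtwist q i (c *\<^sub>C p) = c *\<^sub>C qtwist q i p"
  by (simp add: scale_def qtwist_mult qtwist_const)

lemma qtwist_zero: "qtwist q i 0 = 0"
  by (simp add: qtwist_def)

lemma qtwist_diff: "qtwist q i (p - r) = qtwist q i p - qtwist q i r"
  by (intro poly_mapping_eqI) (simp add: lookup_qtwist lookup_minus right_diff_distrib)

lemma qderiv_var_mult_scale:
  "qderiv q i (nc_var j * p) = (if i = j then p else 0) + q i j *\<^sub>C (nc_var j * qderiv q i p)"
  by (simp add: qderiv_var_mult scale_def mult.assoc)

lemma qderiv_cscale: "qderiv q i (c *\<^sub>C p) = c *\<^sub>C qderiv q i p"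
  by (simp add: scale_def qderiv_scale)

lemma qderiv_zero [simp]: "qderiv q i 0 = 0"
  by (simp add: qderiv_def)

lemma qderiv_diff: "qderiv q i (p - r) = qderiv q i p - qderiv q i r"
  using qderiv_add[of q i "p - r" r] by simp

lemma qderiv_var: "qderiv q i (nc_var j) = (if i = j then 1 else 0)"
  using qderiv_var_mult_scale[of q i j 1] by simp

lemma single_Cons: "Poly_Mapping.single (j # w) c = nc_var j * Poly_Mapping.single w (c :: complex)"
  by (simp add: nc_var_def mult_single plus_list_def)

lemma qderiv_mult: "qderiv q i (p * r) = qderiv q i p * r + qtwist q i p * qderiv q i r"
proof (induction p rule: nc_poly_induct)
  case (single w c)
  show ?case
  proof (induction w)
    case Nil
    have "Poly_Mapping.single [] c = nc_const c"
      by (simp add: nc_const_def)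
    then show ?case
      by (simp add: qderiv_scale qtwist_const qderiv_scale[of q i c 1, simplified])
  next
    case (Cons j w)
    then show ?case
      by (simp add: single_Cons qderiv_var_mult_scale qtwist_mult qtwist_var mult.assoc
          distrib_left distrib_right scale_add_right)
  qed
qed (simp add: qderiv_add qtwist_add algebra_simps)

lemma qderiv_qtwist: "qderiv q j (qtwist q i p) = q i j *\<^sub>C qtwist q i (qderiv q j p)"
proof (induction p rule: nc_poly_induct)
  case (single w c)
  show ?case
  proof (induction w)
    case Nil
    then show ?case
      by (simp add: qtwist_single qderiv_single qtwist_zero)
  next
    case (Cons k w)
    then show ?case
      by (simp add: single_Cons qderiv_var_mult_scale qtwist_mult qtwist_var qtwist_add qtwist_zero
          qtwist_scale qderiv_cscale scale_add_right mult_ac)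
  qed
qed (simp add: qderiv_add qtwist_add scale_add_right)

lemma idealI_free_alg:
  assumes "J \<subseteq> carrier (free_alg l)" "0 \<in> J"
    and "\<And>x y. x \<in> J \<Longrightarrow> y \<in> J \<Longrightarrow> x + y \<in> J"
    and l: "\<And>x a. x \<in> J \<Longrightarrow> a \<in> carrier (free_alg l) \<Longrightarrow> a * x \<in> J"
    and "\<And>x a. x \<in> J \<Longrightarrow> a \<in> carrier (free_alg l) \<Longrightarrow> x * a \<in> J"
  shows "ideal J (free_alg l)"
proof (rule idealI[OF ring_free_alg])
  interpret ring "free_alg l" by (rule ring_free_alg)
  show "subgroup J (add_monoid (free_alg l))"
  proof (rule add.subgroupI)
    fix x assume x: "x \<in> J"
    have "nc_const (-1) \<in> carrier (free_alg l)"
      by (simp add: free_alg_def nc_const_def)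
    then have "nc_const (-1) * x \<in> J"
      using l x by blast
    moreover have "nc_const (-1) * x = - x"
      unfolding scale_def[symmetric] by (simp only: scale_minus_left one_scale)
    ultimately have m: "- x \<in> J" 
      by simp
    then have "\<ominus>\<^bsub>free_alg l\<^esub> x = - x"
      using assms(1) x by (intro minus_equality) (auto simp: free_alg_def)
    then show "\<ominus>\<^bsub>free_alg l\<^esub> x \<in> J"
      using m by simp
  qed (use assms in \<open>auto simp: free_alg_def\<close>)
qed (use assms in \<open>auto simp: free_alg_def\<close>)

lemma q_constants_subset: "q_constants q l \<subseteq> carrier (free_alg l)"
  by (auto simp: q_constants_def)

lemma ideal_q_ideal: "ideal (q_ideal q l) (free_alg l)"
  unfolding q_ideal_def by (rule ring.genideal_ideal[OF ring_free_alg q_constants_subset])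

lemma q_constants_in_q_ideal: "q_constants q l \<subseteq> q_ideal q l"
  unfolding q_ideal_def by (rule ring.genideal_self[OF ring_free_alg q_constants_subset])

lemma q_ideal_least:
  "ideal J (free_alg l) \<Longrightarrow> q_constants q l \<subseteq> J \<Longrightarrow> q_ideal q l \<subseteq> J"
  unfolding q_ideal_def by (rule ring.genideal_minimal[OF ring_free_alg])

lemma qtwist_carrier: "p \<in> carrier (free_alg l) \<Longrightarrow> qtwist q i p \<in> carrier (free_alg l)"
  by (auto simp: free_alg_def in_keys_iff lookup_qtwist)

lemma qderiv_carrier:
  assumes p: "p \<in> carrier (free_alg l)"
  shows "qderiv q i p \<in> carrier (free_alg l)"
proof -
  interpret free_alg_ideal l "carrier (free_alg l)"
    by (rule free_alg_ideal.intro[OF ring.oneideal[OF ring_free_alg]])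
  have zero: "0 \<in> A"
    by (simp add: free_alg_def)
  have word: "set w \<subseteq> {1..l} \<Longrightarrow> qderiv_word q i w \<in> A" for w
  proof (induction w)
    case (Cons j w)
    have "(if i = j then Poly_Mapping.single w 1 else 0) \<in> A"
      using Cons.prems by (auto simp: free_alg_def)
    moreover have "nc_const (q i j) * nc_var j * qderiv_word q i w \<in> A"
      using Cons by (intro A_mult A_const A_var) auto
    ultimately show ?case
      by (simp add: A_add)
  qed (simp add: zero)
  have "(\<Sum>w\<in>S. nc_const (Poly_Mapping.lookup p w) * qderiv_word q i w) \<in> A"
    if "finite S" "\<And>w. w \<in> S \<Longrightarrow> set w \<subseteq> {1..l}" for S
    using that by (induction) (simp_all add: zero A_mult A_add A_const word)
  from this[of "Poly_Mapping.keys p"] show ?thesis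
    using p by (simp add: qderiv_def) (simp add: free_alg_def)
qed

text \<open>The automorphism maps a constant to a constant or to zero, because it commutes with all
derivations up to scalars. A constant need not be homogeneous, so it is not simply an eigenvector.\<close>

lemma qtwist_q_ideal:
  assumes "p \<in> q_ideal q l" and "i \<in> {1..l}"
  shows "qtwist q i p \<in> q_ideal q l"
proof -
  interpret free_alg_ideal l "q_ideal q l"
    by (rule free_alg_ideal.intro[OF ideal_q_ideal])
  let ?J = "{p \<in> A. qtwist q i p \<in> q_ideal q l}"
  have "q_ideal q l \<subseteq> ?J"
  proof (rule q_ideal_least)
    show "ideal ?J (free_alg l)"
      by (rule idealI_free_alg)
        (simp_all add: qtwist_zero qtwist_add qtwist_mult I_lmult I_rmult I_add qtwist_carrier
          A_mult A_add I_subset[OF I_zero] subset_eq)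
    show "q_constants q l \<subseteq> ?J"
    proof
      fix C assume C: "C \<in> q_constants q l"
      show "C \<in> ?J"
      proof (cases "qtwist q i C = 0")
        case True
        then show ?thesis
          using C by (simp add: q_constants_def)
      next
        case False
        then have "qtwist q i C \<in> q_constants q l"
          using C by (simp add: q_constants_def qtwist_carrier lookup_qtwist qderiv_qtwist qtwist_zero)
        then show ?thesis
          using C q_constants_in_q_ideal q_constants_subset by blast
      qed
    qed
  qed
  then show ?thesis
    using assms(1) by blast
qed

text \<open>By the Leibniz rule the elements of the ideal whose derivative stays in the ideal form an ideal
containing the constants; products with an element on the right need the stability under the twist.\<close>

lemma qderiv_q_ideal:
  assumes "p \<in> q_ideal q l" and "i \<in> {1..l}"
  shows "qderiv q i p \<in> q_ideal q l"
proof -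
  interpret free_alg_ideal l "q_ideal q l"
    by (rule free_alg_ideal.intro[OF ideal_q_ideal])
  let ?J = "{p \<in> q_ideal q l. qderiv q i p \<in> q_ideal q l}"
  have "q_ideal q l \<subseteq> ?J"
  proof (rule q_ideal_least)
    show "ideal ?J (free_alg l)"
      by (rule idealI_free_alg)
        (simp_all add: qderiv_mult qderiv_add I_lmult I_rmult I_add I_subset qtwist_carrier
          qderiv_carrier qtwist_q_ideal[OF _ assms(2)] subset_eq)
    show "q_constants q l \<subseteq> ?J"
      using q_constants_in_q_ideal assms(2) by (auto simp: q_constants_def subset_eq)
  qed
  then show ?thesis
    using assms(1) by blast
qed

text \<open>All constants lie in the augmentation ideal.\<close>

lemma nc_const_notin_q_ideal:
  assumes "c \<noteq> 0"
  shows "nc_const c \<notin> q_ideal q l"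
proof
  assume c: "nc_const c \<in> q_ideal q l"
  interpret free_alg_ideal l "q_ideal q l"
    by (rule free_alg_ideal.intro[OF ideal_q_ideal])
  let ?J = "{p \<in> A. Poly_Mapping.lookup p [] = 0}"
  have m: "Poly_Mapping.lookup (x * y) [] = 0"
    if "Poly_Mapping.lookup x [] = 0 \<or> Poly_Mapping.lookup y [] = 0" for x y :: nc_poly
    using that by (auto simp flip: not_in_keys_iff_lookup_eq_zero elim!: keys_mult_append)
  have "q_ideal q l \<subseteq> ?J"
  proof (rule q_ideal_least)
    show "ideal ?J (free_alg l)"
      by (rule idealI_free_alg)
        (simp_all add: m A_mult A_add I_subset[OF I_zero] subset_eq lookup_add)
    show "q_constants q l \<subseteq> ?J"
      by (auto simp: q_constants_def)
  qed
  then show False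
    using c assms by (auto simp: nc_const_def)
qed


section \<open>The quotient algebra\<close>

lemma q_bracket_proj:
  assumes "x \<in> carrier (free_alg l)" "y \<in> carrier (free_alg l)"
  shows "q_bracket q l a (q_proj q l x) (q_proj q l y) = q_proj q l (x * y - a *\<^sub>C (y * x))"
proof -
  interpret free_alg_ideal l "q_ideal q l"
    by (rule free_alg_ideal.intro[OF ideal_q_ideal])
  interpret h: ring_hom_ring "free_alg l" "q_quot q l" "q_proj q l"
    using ideal.rcos_ring_hom_ring[OF ideal_q_ideal] by (simp add: q_quot_def q_proj_def[abs_def])
  have minus: "u \<ominus>\<^bsub>free_alg l\<^esub> v = u - v" if "u \<in> A" "v \<in> A" for u v
  proof -
    have "\<ominus>\<^bsub>free_alg l\<^esub> v = - v"
      using that A_diff[OF I_subset[OF I_zero] that(2)] by (intro h.R.minus_equality) (auto simp: free_alg_def)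
    then show ?thesis
      by (simp add: a_minus_def) (simp add: free_alg_def)
  qed
  have mult: "q_proj q l u \<otimes>\<^bsub>q_quot q l\<^esub> q_proj q l v = q_proj q l (u * v)" if "u \<in> A" "v \<in> A" for u v
    using h.hom_mult[OF that] by (simp add: free_alg_def)
  have diff: "q_proj q l u \<ominus>\<^bsub>q_quot q l\<^esub> q_proj q l v = q_proj q l (u - v)" if "u \<in> A" "v \<in> A" for u v
    using that minus by (metis h.R.minus_closed h.hom_add h.hom_a_inv a_minus_def h.R.a_inv_closed)
  show ?thesis
    using assms by (simp add: q_bracket_def mult diff A_mult A_const scale_def)
qed

lemma q_proj_zero_iff:
  assumes "x \<in> carrier (free_alg l)"
  shows "q_proj q l x = \<zero>\<^bsub>q_quot q l\<^esub> \<longleftrightarrow> x \<in> q_ideal q l"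
proof -
  interpret ideal "q_ideal q l" "free_alg l"
    by (rule ideal_q_ideal)
  show ?thesis
    using a_rcos_self[OF assms] a_rcos_const[of x]
    by (auto simp: q_proj_def q_quot_def FactRing_def)
qed

section \<open>Consequences of general position\<close>

lemma nc_var_power: "nc_var i ^ n = Poly_Mapping.single (replicate n i) 1"
  by (induction n) (simp_all add: nc_one nc_var_def mult_single plus_list_def)

lemma single_one_nonzero: "Poly_Mapping.single (w :: nat list) (1 :: complex) \<noteq> 0"
  by (metis lookup_single_eq lookup_zero zero_neq_one)

text \<open>A family of words closed under taking factors that avoids all words occurring in Serre relations. It
is small, but rich enough to detect the three potential constants $\xi_i^2$, $\xi_1^3$ and
$\xi_{l-1}\xi_l - q_{l,l-1}\xi_l\xi_{l-1}$ that would appear at bad parameters.\<close>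

definition serre_free_word :: "nat \<Rightarrow> nat list \<Rightarrow> bool" where
  "serre_free_word l w \<longleftrightarrow> (\<exists>i. set w \<subseteq> {i}) \<or> w = [l - 1, l] \<or> w = [l, l - 1]"

lemma serre_free_word_append:
  assumes "serre_free_word l (u @ v)"
  shows "serre_free_word l u" "serre_free_word l v"
  using assms by (auto simp: serre_free_word_def append_eq_Cons_conv)

lemma serre_word_not_free:
  assumes "i \<noteq> j" "2 \<le> a + b \<or> a + b = 1 \<and> \<bar>int i - int j\<bar> > 1" "l \<ge> 1"
  shows "\<not> serre_free_word l (replicate a i @ [j] @ replicate b i)"
proof
  let ?w = "replicate a i @ [j] @ replicate b i"
  assume "serre_free_word l ?w"
  moreover have "set ?w = {i, j}"
    using assms(2) by (cases a; cases b) auto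
  ultimately have w: "?w = [l - 1, l] \<or> ?w = [l, l - 1]"
    using assms(1) unfolding serre_free_word_def by blast
  then have "length ?w = 2"
    by (metis length_Cons list.size(3) One_nat_def Suc_1)
  then have "a = 0 \<and> b = 1 \<or> a = 1 \<and> b = 0" and "\<bar>int i - int j\<bar> > 1"
    using assms(2) by auto
  then show False
    using w assms(3) by auto
qed

definition serre_free_ideal :: "nat \<Rightarrow> nc_poly set" where
  "serre_free_ideal l = {p \<in> carrier (free_alg l). \<forall>w. serre_free_word l w \<longrightarrow> Poly_Mapping.lookup p w = 0}"

lemma ideal_serre_free: "ideal (serre_free_ideal l) (free_alg l)"
proof -
  interpret free_alg_ideal l "carrier (free_alg l)"
    by (rule free_alg_ideal.intro[OF ring.oneideal[OF ring_free_alg]])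
  have m: "Poly_Mapping.lookup (x * y) w = 0"
    if "serre_free_word l w"
      "(\<forall>w. serre_free_word l w \<longrightarrow> Poly_Mapping.lookup x w = 0) \<or>
       (\<forall>w. serre_free_word l w \<longrightarrow> Poly_Mapping.lookup y w = 0)" for x y :: nc_poly and w
  proof (rule ccontr)
    assume "Poly_Mapping.lookup (x * y) w \<noteq> 0"
    then have "w \<in> Poly_Mapping.keys (x * y)"
      by (simp add: in_keys_iff)
    then obtain u v where uv: "u \<in> Poly_Mapping.keys x" "v \<in> Poly_Mapping.keys y" "w = u @ v"
      using keys_mult_append by blast
    then have "serre_free_word l u" "serre_free_word l v"
      using that(1) serre_free_word_append by blast+
    then show False
      using that(2) uv by (auto simp: in_keys_iff)
  qed
  show ?thesis
    unfolding serre_free_ideal_def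
    by (rule idealI_free_alg) (simp_all add: m A_mult A_add I_zero lookup_add subset_eq)
qed

lemma C_serre_in_serre_free_ideal:
  assumes "i \<in> {1..l}" "j \<in> {1..l}" "i \<noteq> j"
  shows "C_serre q l i j \<in> serre_free_ideal l"
proof -
  interpret free_alg_ideal l "serre_free_ideal l"
    by (rule free_alg_ideal.intro[OF ideal_serre_free])
  have mono: "nc_const c * nc_var i ^ a * nc_var j * nc_var i ^ b \<in> serre_free_ideal l"
    if "2 \<le> a + b \<or> a + b = 1 \<and> \<bar>int i - int j\<bar> > 1" for a b c
  proof -
    have "nc_const c * nc_var i ^ a * nc_var j * nc_var i ^ b
        = Poly_Mapping.single (replicate a i @ [j] @ replicate b i) c"
      unfolding nc_var_power by (simp add: nc_var_def nc_const_def mult_single plus_list_def)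
    moreover have "\<not> serre_free_word l (replicate a i @ [j] @ replicate b i)"
      using that assms by (intro serre_word_not_free) auto
    ultimately show ?thesis
      using assms by (auto simp: serre_free_ideal_def free_alg_def lookup_single when_def)
  qed
  show ?thesis
  proof (cases "\<bar>int i - int j\<bar> > 1")
    case True
    then show ?thesis
      using mono[of 1 0 1] mono[of 0 1 "q j i"]
      by (simp add: C_serre_def I_diff flip: nc_one nc_const_def del: One_nat_def) 
        (simp add: nc_const_def I_diff flip: nc_one)
  next
    case far: False
    show ?thesis
    proof (cases "i = l - 1 \<and> j = l")
      case True
      have "(\<Sum>m\<in>M. nc_const (c m) * nc_var i ^ m * nc_var j * nc_var i ^ (3 - m)) \<in> serre_free_ideal l"
        if "finite M" for M c
        using that by (induction M) (auto intro!: I_add mono)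
      then show ?thesis
        using far True by (simp add: C_serre_def)
    next
      case False
      have "nc_const (1 / q j i) * nc_var i ^ 2 * nc_var j \<in> serre_free_ideal l"
        "nc_const (1 + q i i) * nc_var i * nc_var j * nc_var i \<in> serre_free_ideal l"
        "nc_const (1 / q i j) * nc_var j * nc_var i ^ 2 \<in> serre_free_ideal l"
        using mono[of 2 0 "1 / q j i"] mono[of 1 1 "1 + q i i"] mono[of 0 2 "1 / q i j"] by simp_all
      then show ?thesis
        unfolding C_serre_def if_not_P[OF far] if_not_P[OF False] by (intro I_add I_diff)
    qed
  qed
qed

locale C_parameters =
  fixes l :: nat and q :: "nat \<Rightarrow> nat \<Rightarrow> complex"
  assumes rank: "l \<ge> 2"
    and constraints: "C_constraints q l"
    and general: "C_general_position q l"

sublocale C_parameters \<subseteq> free_alg_ideal l "q_ideal q l"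
  by (rule free_alg_ideal.intro[OF ideal_q_ideal])

context C_parameters
begin

abbreviation "I \<equiv> q_ideal q l"

abbreviation "e \<equiv> nc_var"

lemma C_serre_relations_subset: "C_serre_relations q l \<subseteq> serre_free_ideal l"
  using C_serre_in_serre_free_ideal by (auto simp: C_serre_relations_def)

lemma serre_free_ideal_carrier: "serre_free_ideal l \<subseteq> A"
  by (auto simp: serre_free_ideal_def)

lemma C_serre_in_ideal:
  assumes "i \<in> {1..l}" "j \<in> {1..l}" "i \<noteq> j"
  shows "C_serre q l i j \<in> I"
proof -
  have "C_serre_relations q l \<subseteq> I"
    using general ring.genideal_self[OF ring_free_alg subset_trans[OF C_serre_relations_subset
      serre_free_ideal_carrier]] by (simp add: C_general_position_def)
  then show ?thesis
    using assms by (auto simp: C_serre_relations_def)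
qed

text \<open>This is the way general position is used: a constant belongs to the Serre ideal and therefore contains
no Serre-free word.\<close>

lemma constant_lookup_serre_free:
  assumes "C \<in> q_constants q l" "serre_free_word l w"
  shows "Poly_Mapping.lookup C w = 0"
proof -
  have "I \<subseteq> serre_free_ideal l"
    using general ring.genideal_minimal[OF ring_free_alg ideal_serre_free C_serre_relations_subset]
    by (simp add: C_general_position_def)
  then show ?thesis
    using assms q_constants_in_q_ideal by (auto simp: serre_free_ideal_def)
qed

lemma far_product:
  assumes "i \<in> {1..l}" "j \<in> {1..l}" "\<bar>int i - int j\<bar> > 1"
  shows "q i j * q j i = 1"
  using constraints assms unfolding C_constraints_def sigma_def by blast

lemma diag_short:
  assumes "i \<in> {1..l}" "i \<noteq> l"
  shows "q i i = q 1 1"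
proof -
  have "i \<in> {1..l - 1}"
    using assms by auto
  then show ?thesis
    using constraints unfolding C_constraints_def by blast
qed

lemma diag_long: "q l l = (q 1 1)\<^sup>2"
  using constraints unfolding C_constraints_def by blast

lemma long_product: "q (l - 1) l * q l (l - 1) * (q 1 1)\<^sup>2 = 1"
proof -
  have "q l (l - 1) * q (l - 1) l * q l l = 1"
    using constraints unfolding C_constraints_def sigma_def by blast
  then show ?thesis
    unfolding diag_long by (simp add: mult_ac)
qed

lemma near_product:
  assumes "i \<in> {1..l}" "j \<in> {1..l}" "\<bar>int i - int j\<bar> = 1" "\<not> (i = l - 1 \<and> j = l)"
  shows "q i j * q j i * q i i = 1"
proof (cases "i = l")
  case True
  then have "j = l - 1"
    using assms by auto
  then show ?thesis
    using long_product diag_long True by (simp add: mult_ac)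
next
  case False
  then have "j \<noteq> l"
    using assms by auto
  then have "i \<in> {1..l - 1}" "j \<in> {1..l - 1}"
    using False assms by auto
  then show ?thesis
    using constraints assms(3) unfolding C_constraints_def sigma_def by blast
qed

lemma q11_nonzero: "q 1 1 \<noteq> 0"
proof
  assume "q 1 1 = 0"
  then show False
    using long_product by (simp only:) simp
qed

lemma q_nonzero:
  assumes "i \<in> {1..l}" "j \<in> {1..l}"
  shows "q i j \<noteq> 0"
proof
  assume 0: "q i j = 0"
  have "i \<noteq> j"
  proof
    assume "i = j"
    then have "q i j = q 1 1 \<or> q i j = (q 1 1)\<^sup>2"
      using assms diag_short diag_long by blast
    then show False
      using 0 q11_nonzero by simp
  qed
  moreover have "\<not> \<bar>int i - int j\<bar> > 1"
    using far_product[OF assms] 0 by force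
  ultimately have "\<bar>int i - int j\<bar> = 1"
    by linarith
  then have "i = l - 1 \<and> j = l"
    using near_product[OF assms] 0 by force
  then show False
    using long_product 0 by simp
qed

lemma e_carrier: "i \<in> {1..l} \<Longrightarrow> e i \<in> A"
  by (rule A_var)

text \<open>Otherwise $\xi_i^2$ is a constant.\<close>

lemma one_plus_diag_nonzero:
  assumes "i \<in> {1..l}"
  shows "1 + q i i \<noteq> 0"
proof
  assume 0: "1 + q i i = 0"
  have s: "e i * e i = Poly_Mapping.single [i, i] 1"
    by (simp add: nc_var_def mult_single plus_list_def)
  have "qderiv q j (e i * e i) = 0" for j
  proof -
    have "qderiv q i (e i * e i) = (1 + q i i) *\<^sub>C e i"
      by (simp add: qderiv_var_mult_scale qderiv_var scale_add_left)
    then show ?thesis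
      using 0 by (cases "j = i") (simp_all add: qderiv_var_mult_scale qderiv_var)
  qed
  moreover have "e i * e i \<noteq> 0" "Poly_Mapping.lookup (e i * e i) [] = 0"
    unfolding s by (simp_all add: single_one_nonzero lookup_single)
  ultimately have "e i * e i \<in> q_constants q l"
    using assms by (simp add: q_constants_def A_mult A_var)
  moreover have "serre_free_word l [i, i]"
    by (auto simp: serre_free_word_def)
  ultimately show False
    using constant_lookup_serre_free[of "e i * e i" "[i, i]"] by (simp add: s lookup_single)
qed

text \<open>Otherwise $\xi_1^3$ is a constant.\<close>

lemma quadratic_nonzero: "1 + q 1 1 + (q 1 1)\<^sup>2 \<noteq> 0"
proof
  let ?C = "e 1 * (e 1 * e 1)"
  assume 0: "1 + q 1 1 + (q 1 1)\<^sup>2 = 0"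
  have s: "?C = Poly_Mapping.single [1, 1, 1] 1"
    by (simp add: nc_var_def mult_single plus_list_def)
  have "qderiv q j ?C = 0" for j
  proof -
    have "qderiv q 1 ?C = (1 + q 1 1 + (q 1 1)\<^sup>2) *\<^sub>C (e 1 * e 1)"
      by (simp add: qderiv_var_mult_scale qderiv_var scale_simps algebra_simps power2_eq_square)
    then show ?thesis
      using 0 by (cases "j = 1") (simp_all add: qderiv_var_mult_scale qderiv_var)
  qed
  moreover have "?C \<noteq> 0" "Poly_Mapping.lookup ?C [] = 0"
    unfolding s by (simp_all only: single_one_nonzero lookup_single) simp_all
  ultimately have "?C \<in> q_constants q l"
    using rank by (simp add: q_constants_def A_mult A_var)
  moreover have "serre_free_word l [1, 1, 1]"
    by (auto simp: serre_free_word_def)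
  ultimately show False
    using constant_lookup_serre_free[of ?C "[1, 1, 1]"] unfolding s by simp
qed

text \<open>If $\mathbf{q} = 1$, then $\sigma_{l-1,l} = 1$ and $\xi_{l-1}\xi_l - q_{l,l-1}\xi_l\xi_{l-1}$ is a constant.\<close>

lemma q11_neq_1: "q 1 1 \<noteq> 1"
proof
  assume "q 1 1 = 1"
  then have p: "q (l - 1) l * q l (l - 1) = 1"
    using long_product by simp
  let ?a = "l - 1"
  let ?C = "e ?a * e l - q l ?a *\<^sub>C (e l * e ?a)"
  have ne: "?a \<noteq> l" "?a \<in> {1..l}" "l \<in> {1..l}"
    using rank by auto
  have s: "?C = Poly_Mapping.single [?a, l] 1 - Poly_Mapping.single [l, ?a] (q l ?a)"
    by (simp add: scale_def nc_const_def nc_var_def mult_single plus_list_def)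
  have "qderiv q j ?C = 0" for j
    using ne p by (auto simp: qderiv_diff qderiv_cscale qderiv_var_mult_scale qderiv_var scale_simps mult_ac)
  moreover have L: "Poly_Mapping.lookup ?C [?a, l] = 1" "Poly_Mapping.lookup ?C [] = 0"
    using ne unfolding s by (auto simp: lookup_single lookup_minus)
  moreover have "?C \<noteq> 0"
    using L(1) by auto
  ultimately have "?C \<in> q_constants q l"
    using ne by (simp add: q_constants_def A_mult A_var A_diff A_scale)
  moreover have "serre_free_word l [?a, l]"
    by (simp add: serre_free_word_def)
  ultimately show False
    using constant_lookup_serre_free[of ?C "[?a, l]"] L by simp
qed

lemma diag_neq_1:
  assumes "i \<in> {1..l}"
  shows "q i i \<noteq> 1"
proof -
  have "q 1 1 \<noteq> - 1"
    using one_plus_diag_nonzero[of 1] rank by auto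
  then have "(q 1 1)\<^sup>2 \<noteq> 1"
    using q11_neq_1 by (simp only: power2_eq_1_iff) simp
  then show ?thesis
    using assms q11_neq_1 diag_short[of i] diag_long by metis
qed

lemma far_commute:
  assumes "i \<in> {1..l}" "j \<in> {1..l}" "\<bar>int i - int j\<bar> > 1"
  shows "qad (e i) (q j i) (e j) \<in> I"
proof -
  have "C_serre q l i j \<in> I"
    using assms by (intro C_serre_in_ideal) auto
  then show ?thesis
    unfolding C_serre_def if_P[OF assms(3)] by (simp only: qad_def scale_def mult.assoc)
qed

text \<open>The quadratic in left and right multiplication by $\xi_i$ factors: its two roots have sum
$q_{ji}(1+q_{ii})$ and, since $\sigma_{ij}q_{ii} = 1$, product $q_{ji}/q_{ij} = q_{ji}^2q_{ii}$.\<close>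

lemma near_serre:
  assumes "i \<in> {1..l}" "j \<in> {1..l}" "\<bar>int i - int j\<bar> = 1" "\<not> (i = l - 1 \<and> j = l)"
  shows "qad (e i) (q j i * q i i) (qad (e i) (q j i) (e j)) \<in> I"
proof -
  have nz: "q i j \<noteq> 0" "q j i \<noteq> 0"
    using q_nonzero assms by auto
  have s: "q j i * q j i * q i i = q j i / q i j"
    using near_product[OF assms] nz by (simp add: field_simps)
  have "q j i *\<^sub>C C_serre q l i j \<in> I"
    using C_serre_in_ideal[of i j] assms by (intro I_scale) auto
  also have "q j i *\<^sub>C C_serre q l i j = e i * (e i * e j) - (q j i * (1 + q i i)) *\<^sub>C (e i * (e j * e i))
      + (q j i / q i j) *\<^sub>C (e j * (e i * e i))"
  proof -
    have "\<not> \<bar>int i - int j\<bar> > 1"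
      using assms(3) by simp
    then have "C_serre q l i j = (1 / q j i) *\<^sub>C (e i * (e i * e j))
        - (1 + q i i) *\<^sub>C (e i * (e j * e i)) + (1 / q i j) *\<^sub>C (e j * (e i * e i))"
      unfolding C_serre_def if_not_P[OF assms(4)]
      by (simp only: if_False power2_eq_square mult.assoc scale_def)
    then show ?thesis
      using nz by (simp only: scale_add_right scale_diff_right scale_scale) simp
  qed
  also have "\<dots> = qad (e i) (q j i * q i i) (qad (e i) (q j i) (e j))"
    unfolding s[symmetric] by (simp add: qad_def scale_simps algebra_simps)
  finally show ?thesis .
qed

text \<open>By the q-binomial theorem the cubic factors with roots $1/(c\,t^k)$ for $k = 0, 1, 2$, where
$c = q_{l-1,l}$; as $c\,d\,t^2 = 1$, these are $d\,t^2$, $d\,t$, $d$.\<close>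

lemma long_serre:
  defines "f \<equiv> e (l - 1)" and "g \<equiv> e l" and "d \<equiv> q l (l - 1)" and "t \<equiv> q 1 1"
  shows "qad f (d * t\<^sup>2) (qad f (d * t) (qad f d g)) \<in> I"
proof -
  define c where "c = q (l - 1) l"
  have ct: "c * d * t\<^sup>2 = 1"
    using long_product by (simp add: c_def d_def t_def)
  have diag: "q (l - 1) (l - 1) = t"
    using diag_short[of "l - 1"] rank by (simp add: t_def)
  have S: "C_serre q l (l - 1) l = g * (f * (f * f)) - (c * (1 + t + t\<^sup>2)) *\<^sub>C (f * (g * (f * f)))
     + (c\<^sup>2 * t * (1 + t + t\<^sup>2)) *\<^sub>C (f * (f * (g * f))) - (c ^ 3 * t ^ 3) *\<^sub>C (f * (f * (f * g)))"
  proof -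
    have G: "gauss_binomial t 3 0 = 1" "gauss_binomial t 3 1 = 1 + t + t\<^sup>2"
      "gauss_binomial t 3 2 = 1 + t + t\<^sup>2" "gauss_binomial t 3 3 = 1"
      by (simp_all add: numeral_eq_Suc algebra_simps power2_eq_square)
    define K where "K m = (- c) ^ m * t ^ (m * (m - 1) div 2) * gauss_binomial t 3 m" for m
    have K: "K 0 = 1" "K 1 = - (c * (1 + t + t\<^sup>2))" "K 2 = c\<^sup>2 * t * (1 + t + t\<^sup>2)"
      "K 3 = - (c ^ 3 * t ^ 3)"
      unfolding K_def G by simp_all
    have far: "\<not> \<bar>int (l - 1) - int l\<bar> > 1"
      using rank by auto
    have "C_serre q l (l - 1) l = (\<Sum>m\<le>3. K m *\<^sub>C (f ^ m * (g * f ^ (3 - m))))"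
      unfolding C_serre_def if_not_P[OF far] diag
      by (simp add: K_def f_def g_def c_def mult.assoc scale_def)
    also have "{..3::nat} = {0, 1, 2, 3}"
      by auto
    finally have "C_serre q l (l - 1) l = K 0 *\<^sub>C (f ^ 0 * (g * f ^ (3 - 0))) 
        + (K 1 *\<^sub>C (f ^ 1 * (g * f ^ (3 - 1))) + (K 2 *\<^sub>C (f ^ 2 * (g * f ^ (3 - 2)))
        + K 3 *\<^sub>C (f ^ 3 * (g * f ^ (3 - 3)))))"
      by simp
    then show ?thesis
      unfolding K by (simp add: power2_eq_square power3_eq_cube mult.assoc scale_minus_left)
  qed
  have eqs: "d ^ 3 * t ^ 3 * (c ^ 3 * t ^ 3) = 1"
    "d ^ 3 * t ^ 3 * (c\<^sup>2 * t * (1 + t + t\<^sup>2)) = d * (1 + t + t\<^sup>2)"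
    "d ^ 3 * t ^ 3 * (c * (1 + t + t\<^sup>2)) = d\<^sup>2 * t * (1 + t + t\<^sup>2)"
  proof -
    have "d ^ 3 * t ^ 3 * (c ^ 3 * t ^ 3) = (c * d * t\<^sup>2) ^ 3"
      "d ^ 3 * t ^ 3 * (c\<^sup>2 * t * (1 + t + t\<^sup>2)) = d * (c * d * t\<^sup>2)\<^sup>2 * (1 + t + t\<^sup>2)"
      "d ^ 3 * t ^ 3 * (c * (1 + t + t\<^sup>2)) = d\<^sup>2 * t * (c * d * t\<^sup>2) * (1 + t + t\<^sup>2)"
      by (simp_all only: power2_eq_square power3_eq_cube mult_ac)
    then show "d ^ 3 * t ^ 3 * (c ^ 3 * t ^ 3) = 1"
      "d ^ 3 * t ^ 3 * (c\<^sup>2 * t * (1 + t + t\<^sup>2)) = d * (1 + t + t\<^sup>2)"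
      "d ^ 3 * t ^ 3 * (c * (1 + t + t\<^sup>2)) = d\<^sup>2 * t * (1 + t + t\<^sup>2)"
      unfolding ct by simp_all
  qed
  have "(- (d ^ 3 * t ^ 3)) *\<^sub>C C_serre q l (l - 1) l \<in> I"
    using rank by (intro I_scale C_serre_in_ideal) auto
  also have "(- (d ^ 3 * t ^ 3)) *\<^sub>C C_serre q l (l - 1) l
     = f * (f * (f * g)) - (d * (1 + t + t\<^sup>2)) *\<^sub>C (f * (f * (g * f)))
       + (d\<^sup>2 * t * (1 + t + t\<^sup>2)) *\<^sub>C (f * (g * (f * f))) - (d ^ 3 * t ^ 3) *\<^sub>C (g * (f * (f * f)))"
    unfolding S by (simp add: scale_minus_left scale_add_right scale_diff_right eqs del: scale_minus_right)
  also have "\<dots> = qad f (d * t\<^sup>2) (qad f (d * t) (qad f d g))"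
    by (simp add: qad_def scale_simps algebra_simps power2_eq_square power3_eq_cube)
  finally show ?thesis .
qed

section \<open>The sequence of root vectors\<close>

text \<open>The index bracketed on in step \<open>m\<close>. The values at \<open>0\<close> and at \<open>2 * l\<close> are \<open>0\<close>, which is no index of a
generator: there is no letter before the first and none after the last.\<close>

definition letter :: "nat \<Rightarrow> nat" where
  "letter m = (if m \<le> l then m else 2 * l - m)"

lemma letter_0 [simp]: "letter 0 = 0"
  by (simp add: letter_def)

lemma letter_range: "1 \<le> m \<Longrightarrow> m \<le> 2 * l - 1 \<Longrightarrow> letter m \<in> {1..l}"
  by (auto simp: letter_def)

lemma letter_end: "letter (2 * l) = 0"
  using rank by (simp add: letter_def)

lemma letter_distinct: "m < 2 * l \<Longrightarrow> letter m \<noteq> letter (Suc m)"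
  by (auto simp: letter_def split: if_splits)

lemma letter_neighbours:
  assumes "i \<in> {1..l}" "Suc m < 2 * l"
  shows "\<bar>int i - int (letter (Suc m))\<bar> = 1 \<longleftrightarrow> i = letter m \<or> i = letter (Suc (Suc m))"
  using assms by (auto simp: letter_def split: if_splits)

text \<open>The preceding and the next letter agree only at the turning point.\<close>

lemma letter_turn:
  assumes "i \<in> {1..l}" "Suc m < 2 * l"
  shows "i = letter m \<and> i = letter (Suc (Suc m)) \<longleftrightarrow> i = l - 1 \<and> letter (Suc m) = l"
  using assms by (auto simp: letter_def split: if_splits)

lemma letter_eq_long: "Suc m < 2 * l \<Longrightarrow> letter (Suc m) = l \<longleftrightarrow> Suc m = l"
  by (auto simp: letter_def split: if_splits)

text \<open>The value of the bicharacter $\chi(r_i, r_j) = q_{ij}$ on $r_i$ and the weight of $X^m$; below, in the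
other order.\<close>

definition left_char :: "nat \<Rightarrow> nat \<Rightarrow> complex" where
  "left_char m i = (\<Prod>k=1..m. q i (letter k))"

definition right_char :: "nat \<Rightarrow> nat \<Rightarrow> complex" where
  "right_char m i = (\<Prod>k=1..m. q (letter k) i)"

lemma char_0 [simp]: "left_char 0 i = 1" "right_char 0 i = 1"
  by (simp_all add: left_char_def right_char_def)

lemma char_Suc:
  "left_char (Suc m) i = left_char m i * q i (letter (Suc m))"
  "right_char (Suc m) i = right_char m i * q (letter (Suc m)) i"
  by (simp_all add: left_char_def right_char_def)

text \<open>A correction for the generator with index 1: the scalar from which the sequence starts must fail to
q-commute with it; see \<open>root_poly\<close>.\<close>

definition first_factor :: "nat \<Rightarrow> complex" where
  "first_factor i = (if i = 1 then q 1 1 else 1)"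

lemma first_factor_nonzero: "first_factor i \<noteq> 0"
  using q11_nonzero by (simp add: first_factor_def)

text \<open>This product only depends on the pairing of $r_i$ with the weight of $X^m$. Adding the next letter $j$
multiplies it by $\sigma_{ij}$, which the constraints determine: it is $q_{jj}^2$ for $i = j$, trivial
for distant letters and inverse to $q_{ii}$ for neighbours, except that $\sigma_{l-1,l} = \mathbf{q}^{-2}$. At the turning
point this exception turns the value for the preceding letter $l-1$ into the value for the next one.\<close>

lemma char_product:
  assumes "m < 2 * l" "i \<in> {1..l}"
  shows "left_char m i * right_char m i =
    (if i = letter (Suc m) then first_factor i / q i i
     else if i = letter m then first_factor i * q i i else first_factor i)"
  using assms
proof (induction m arbitrary: i)
  case 0
  then show ?case
    using rank q11_nonzero by (auto simp: letter_def first_factor_def)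
next
  case (Suc m)
  define j where "j = letter (Suc m)"
  have j: "j \<in> {1..l}"
    using letter_range[of "Suc m"] Suc.prems unfolding j_def by auto
  have qnz: "q i i \<noteq> 0"
    using q_nonzero Suc.prems by blast
  have IH: "left_char m i * right_char m i =
    (if i = j then first_factor i / q i i
     else if i = letter m then first_factor i * q i i else first_factor i)"
    using Suc unfolding j_def by auto
  have step: "left_char (Suc m) i * right_char (Suc m) i
      = left_char m i * right_char m i * (q i j * q j i)"
    unfolding char_Suc j_def by (simp only: mult_ac)
  have nb: "\<bar>int i - int j\<bar> = 1 \<longleftrightarrow> i = letter m \<or> i = letter (Suc (Suc m))"
    using letter_neighbours Suc.prems unfolding j_def by blast
  have turn: "i = letter m \<and> i = letter (Suc (Suc m)) \<longleftrightarrow> i = l - 1 \<and> j = l"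
    using letter_turn Suc.prems unfolding j_def by blast
  have d2: "j \<noteq> letter (Suc (Suc m))"
    using letter_distinct[of "Suc m"] Suc.prems unfolding j_def by blast
  consider "i = j" | "i = letter m" "i = letter (Suc (Suc m))"
    | "i \<noteq> j" "i = letter m" "i \<noteq> letter (Suc (Suc m))"
    | "i \<noteq> j" "i \<noteq> letter m" "i = letter (Suc (Suc m))"
    | "i \<noteq> j" "i \<noteq> letter m" "i \<noteq> letter (Suc (Suc m))"
    by blast
  then show ?case
  proof cases
    case 1
    then show ?thesis
      using d2 qnz unfolding step IH j_def[symmetric] by simp
  next
    case 2
    then have t: "i = l - 1" "j = l"
      using turn by auto
    then have i: "q i i = q 1 1" "i \<noteq> j" 
      using diag_short[of i] Suc.prems rank by auto
    have "q i j * q j i = 1 / (q i i)\<^sup>2"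
      using long_product qnz unfolding i(1) unfolding t by (simp add: field_simps)
    then show ?thesis
      using 2 i(2) qnz unfolding step IH j_def[symmetric] by (simp add: power2_eq_square)
  next
    case 3
    then have "q i j * q j i * q i i = 1"
      using nb turn j Suc.prems by (intro near_product) auto
    then show ?thesis
      using 3 unfolding step IH j_def[symmetric] by (simp add: mult_ac)
  next
    case 4
    then have "q i j * q j i * q i i = 1"
      using nb turn j Suc.prems by (intro near_product) auto
    then show ?thesis
      using 4 qnz unfolding step IH j_def[symmetric] by (simp add: field_simps)
  next
    case 5
    then have "\<bar>int i - int j\<bar> > 1"
      using nb by auto
    then have "q i j * q j i = 1"
      using far_product j Suc.prems by blast
    then show ?thesis
      using 5 unfolding step IH j_def[symmetric] by simp
  qed
qed

text \<open>The factor in \<open>e i * X = kappa m i * X * e i\<close> for the \<open>m\<close>-th element of the sequence.\<close>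

definition kappa :: "nat \<Rightarrow> nat \<Rightarrow> complex" where
  "kappa m i = right_char m i / first_factor i"

lemma kappa_Suc: "kappa (Suc m) i = kappa m i * q (letter (Suc m)) i"
  by (simp add: kappa_def char_Suc)

lemma kappa_nonzero:
  assumes "m \<le> 2 * l - 1" "i \<in> {1..l}"
  shows "kappa m i \<noteq> 0"
proof -
  have "q (letter k) i \<noteq> 0" if "k \<in> {1..m}" for k
    using that assms letter_range by (intro q_nonzero) auto
  then show ?thesis
    by (simp add: kappa_def right_char_def first_factor_nonzero)
qed

text \<open>This form of the bracket coefficient matches $a_n$ and $b_n$ and shows that the derivation for the next
letter does not vanish.\<close>

lemma inverse_kappa:
  assumes "m < 2 * l - 1" "j = letter (Suc m)"
  shows "1 / kappa m j = left_char m j * q j j"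
proof -
  have j: "j \<in> {1..l}"
    using letter_range[of "Suc m"] assms by auto
  have "left_char m j * right_char m j = first_factor j / q j j"
    using char_product[of m j] j assms by auto
  moreover have "right_char m j \<noteq> 0"
    using kappa_nonzero[of m j] assms j by (auto simp: kappa_def)
  ultimately show ?thesis
    using q_nonzero[OF j j] by (simp add: kappa_def field_simps)
qed

text \<open>Representatives of the elements $X^m$ in the free algebra. The sequence is started one step earlier,
with a scalar: a scalar q-commutes with every generator except the first one, for which
\<open>kappa 0 1 = 1 / q 1 1\<close> makes it fail as if the first letter were next. With the normalization
\<open>1 / (1 - q 1 1)\<close> its bracket with the first generator is $\xi_1$.\<close>

primrec root_poly :: "nat \<Rightarrow> nc_poly" where
  "root_poly 0 = nc_const (1 / (1 - q 1 1))"
| "root_poly (Suc m) = root_poly m * e (letter (Suc m))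
     - (1 / kappa m (letter (Suc m))) *\<^sub>C (e (letter (Suc m)) * root_poly m)"

lemma root_poly_1: "root_poly (Suc 0) = e 1"
proof -
  have l1: "letter (Suc 0) = 1"
    using rank by (simp add: letter_def)
  have c: "nc_const c = c *\<^sub>C 1" for c
    by (simp add: scale_def)
  have k: "1 / kappa 0 1 = q 1 1"
    by (simp add: kappa_def first_factor_def)
  have "root_poly (Suc 0) = (1 / (1 - q 1 1) - q 1 1 * (1 / (1 - q 1 1))) *\<^sub>C e 1"
    unfolding root_poly.simps l1 c k by (simp add: scale_diff_left)
  also have "1 / (1 - q 1 1) - q 1 1 * (1 / (1 - q 1 1)) = 1"
    using q11_neq_1 by (simp only: diff_divide_distrib[symmetric] mult_1_right times_divide_eq_right) simp
  finally show ?thesis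
    by simp
qed

lemma root_poly_carrier: "m \<le> 2 * l - 1 \<Longrightarrow> root_poly m \<in> A"
proof (induction m)
  case (Suc m)
  then have "e (letter (Suc m)) \<in> A"
    using letter_range by (intro e_carrier) auto
  then show ?case
    using Suc by (simp add: A_diff A_mult A_scale)
qed (simp add: A_const)

lemma root_poly_Suc_qad:
  assumes "m < 2 * l - 1" "j = letter (Suc m)"
  shows "root_poly (Suc m) = (- (1 / kappa m j)) *\<^sub>C qad (e j) (kappa m j) (root_poly m)"
proof -
  have "kappa m j \<noteq> 0"
    using kappa_nonzero[of m j] letter_range[of "Suc m"] assms by auto
  then show ?thesis
    using assms by (simp add: qad_def scale_diff_right scale_minus_left)
qed

text \<open>The induction needs three earlier elements of the sequence at the turning point, because there \<open>U\<close> in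
\<open>serre_cube_exchange\<close> is three steps back. In each case the factor \<open>kappa m i\<close> is the one produced by
the Leibniz rule, and the constraint $\sigma_{pj}q_{pp} = 1$ (respectively
$\sigma_{l-1,l}\mathbf{q}^2 = 1$) makes the bracket coefficient the one that the exchange lemmas force.\<close>

lemma root_poly_commute:
  assumes "m \<le> 2 * l - 1" "i \<in> {1..l}" "i \<noteq> letter (Suc m)"
  shows "qad (e i) (kappa m i) (root_poly m) \<in> I"
  using assms
proof (induction m arbitrary: i rule: less_induct)
  case (less m)
  consider "m = 0" | "m = 1" | k where "m = Suc (Suc k)"
    by (metis One_nat_def not0_implies_Suc)
  then show ?case
  proof cases
    case 1
    then have "i \<noteq> 1"
      using less.prems rank by (auto simp: letter_def)
    then have "kappa 0 i = 1"
      by (simp add: kappa_def first_factor_def)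
    then show ?thesis
      unfolding 1 by (simp add: qad_def nc_const_commute)
  next
    case 2
    have l: "letter 1 = 1" "letter (Suc 1) = 2"
      using rank by (auto simp: letter_def)
    have k: "kappa 1 i = q 1 i / first_factor i"
      using l by (simp add: kappa_def right_char_def)
    have r: "root_poly 1 = e 1"
      using root_poly_1 by (simp only: One_nat_def)
    show ?thesis
    proof (cases "i = 1")
      case True
      then show ?thesis
        unfolding 2 k r using q11_nonzero by (simp add: first_factor_def qad_def)
    next
      case False
      then have "\<bar>int i - int 1\<bar> > 1"
        using less.prems l 2 by auto
      then have "qad (e i) (q 1 i) (e 1) \<in> I"
        using less.prems rank by (intro far_commute) auto
      then show ?thesis
        unfolding 2 k r using False by (simp add: first_factor_def)
    qed
  next
    case (3 k)
    define p j where "p = letter (Suc k)" and "j = letter (Suc (Suc k))"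
    define X where "X = root_poly (Suc k)"
    have bound: "Suc (Suc k) < 2 * l"
      using less.prems 3 by auto
    have pj: "p \<in> {1..l}" "j \<in> {1..l}"
      using letter_range bound by (auto simp: p_def j_def)
    have neq: "p \<noteq> j" "i \<noteq> letter (Suc m)"
      using letter_distinct[of "Suc k"] bound less.prems by (auto simp: p_def j_def)
    have IH: "qad (e a) (kappa n a) (root_poly n) \<in> I"
      if "n < m" "a \<in> {1..l}" "a \<noteq> letter (Suc n)" for n a
      using less.IH[OF that(1) _ that(2,3)] that(1) less.prems by simp
    have X: "X = root_poly k * e p - (1 / kappa k p) *\<^sub>C (e p * root_poly k)"
      by (simp add: X_def p_def)
    have carr: "root_poly k \<in> A" "X \<in> A" "e i \<in> A" "e j \<in> A" "e p \<in> A"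
      using root_poly_carrier bound pj less.prems e_carrier by (auto simp: X_def simp del: root_poly.simps)
    have target: "root_poly m = X * e j - (1 / kappa (Suc k) j) *\<^sub>C (e j * X)"
      unfolding 3 X_def j_def by (rule root_poly.simps)
    have nb: "\<bar>int i - int j\<bar> = 1 \<longleftrightarrow> i = p \<or> i = letter (Suc m)"
      using letter_neighbours[of i "Suc k"] less.prems bound by (simp add: 3 p_def j_def)
    have kp: "kappa (Suc k) a = kappa k a * q p a" "kappa m a = kappa (Suc k) a * q j a" for a
      by (simp_all add: kappa_Suc 3 p_def j_def)
    consider (far) "\<bar>int i - int j\<bar> > 1" | (self) "i = j" "Suc k \<noteq> l" | (turn) "i = j" "Suc k = l"
      | (previous) "i = p"
      using nb neq by linarith
    then show ?thesis
    proof cases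
      case far
      have "qad (e i) (kappa (Suc k) i) X \<in> I"
        using far less.prems 3 unfolding X_def by (intro IH) (auto simp: j_def)
      then have "qad (e i) (kappa (Suc k) i * q j i) (X * e j - (1 / kappa (Suc k) j) *\<^sub>C (e j * X)) \<in> I"
        using carr far_commute[OF less.prems(2) pj(2) far] by (intro qad_bracket_in_ideal)
      then show ?thesis
        by (simp only: target kp)
    next
      case self
      have "\<not> (j = l - 1 \<and> p = l)"
        using self bound letter_eq_long[of k] by (auto simp: p_def)
      moreover have "\<bar>int j - int p\<bar> = 1"
        using letter_neighbours[of j k] pj bound by (simp add: p_def j_def)
      ultimately have g: "qad (e j) (q p j * q j j) (qad (e j) (q p j) (e p)) \<in> I"
        using pj by (intro near_serre)
      have U: "qad (e j) (kappa k j) (root_poly k) \<in> I"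
        using pj neq 3 by (intro IH) (auto simp: p_def)
      have "qad (e j) (kappa k j * (q p j * q j j)) (qad (e j) (kappa k j * q p j) X) \<in> I"
        unfolding X by (rule serre_square_bracket[OF carr(4,1,5) U g])
      then have "qad (e j) (kappa m j) (qad (e j) (kappa (Suc k) j) X) \<in> I"
        by (simp only: kp mult.assoc)
      then have "qad (e j) (kappa m j) (root_poly m) \<in> I"
        using bound unfolding 3 by (subst root_poly_Suc_qad[of "Suc k" j])
          (auto simp: j_def X_def qad_scale simp del: root_poly.simps intro: I_scale)
      then show ?thesis
        using self by simp
    next
      case turn
      then obtain h where h: "k = Suc h"
        using rank by (cases k) auto
      have lj: "j = l - 1" "p = l" "letter k = l - 1"
        using turn rank by (auto simp: j_def p_def letter_def)
      let ?f = "e (l - 1)"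
      have jl: "l - 1 \<in> {1..l}" "l \<in> {1..l}"
        using rank by auto
      have diag: "q (l - 1) (l - 1) = q 1 1"
        using diag_short[of "l - 1"] rank by auto
      have kk: "kappa k (l - 1) = kappa h (l - 1) * q 1 1" "kappa k l = kappa h l * q (l - 1) l"
        using kappa_Suc[of h] lj(3) diag by (simp_all only: h)
      have h_nz: "kappa h (l - 1) \<noteq> 0" "kappa h l \<noteq> 0" "q (l - 1) l \<noteq> 0"
        using bound kappa_nonzero[of h] q_nonzero jl h by auto
      have Y: "root_poly k = root_poly h * ?f - (1 / kappa h (l - 1)) *\<^sub>C (?f * root_poly h)"
        unfolding h root_poly.simps lj(3)[unfolded h] ..
      have hA: "root_poly h \<in> A" "?f \<in> A" "e l \<in> A"
        using root_poly_carrier bound h jl e_carrier by auto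
      have fY: "qad ?f (kappa h (l - 1) * q 1 1) (root_poly k) \<in> I"
        unfolding kk(1)[symmetric] using jl lj 3 by (intro IH) (auto simp: p_def)
      have gU: "qad (e l) (kappa h l) (root_poly h) \<in> I"
        using jl lj(3) 3 h rank by (intro IH) auto
      have coeff: "(q 1 1)\<^sup>2 * q l (l - 1) / kappa h l = 1 / kappa k l"
        using long_product h_nz unfolding kk by (simp add: field_simps)
      have "qad ?f (kappa h (l - 1) * (q 1 1)\<^sup>2 * q l (l - 1))
         (qad ?f (kappa h (l - 1) * q 1 1 * q l (l - 1))
           (root_poly k * e l - (1 / kappa k l) *\<^sub>C (e l * root_poly k))) \<in> I"
        unfolding coeff[symmetric]
        by (rule serre_cube_exchange[OF hA(2,3,1) h_nz(1,2) quadratic_nonzero Y fY gU long_serre])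
      also have "root_poly k * e l - (1 / kappa k l) *\<^sub>C (e l * root_poly k) = X"
        by (simp only: X lj)
      also have "kappa h (l - 1) * q 1 1 * q l (l - 1) = kappa (Suc k) j"
        by (simp only: kp kk lj)
      also have "kappa h (l - 1) * (q 1 1)\<^sup>2 * q l (l - 1) = kappa m j"
        by (simp only: kp kk lj diag power2_eq_square mult_ac)
      finally have "qad (e j) (kappa m j) (qad (e j) (kappa (Suc k) j) X) \<in> I"
        by (simp only: lj)
      then have "qad (e j) (kappa m j) (root_poly m) \<in> I"
        using bound unfolding 3 by (subst root_poly_Suc_qad[of "Suc k" j])
          (auto simp: j_def X_def qad_scale simp del: root_poly.simps intro: I_scale)
      then show ?thesis
        using turn by simp
    next
      case previous
      have dist: "\<bar>int p - int j\<bar> = 1"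
        using nb previous by simp
      have short: "\<not> (p = l - 1 \<and> j = l)"
        using letter_turn[of i "Suc k"] previous neq less.prems bound by (auto simp: 3 p_def j_def)
      have nz: "kappa k p \<noteq> 0" "kappa k j \<noteq> 0" "1 + q p p \<noteq> 0" "q p j \<noteq> 0" "q j p \<noteq> 0"
        using kappa_nonzero bound pj one_plus_diag_nonzero q_nonzero by auto
      have fY: "qad (e p) (kappa k p * q p p) X \<in> I"
        unfolding X_def kp(1)[of p, symmetric] using pj neq 3 by (intro IH) (auto simp: j_def)
      have gU: "qad (e j) (kappa k j) (root_poly k) \<in> I"
        using pj neq 3 by (intro IH) (auto simp: p_def)
      have g: "qad (e p) (q j p * q p p) (qad (e p) (q j p) (e j)) \<in> I"
        using pj dist short by (intro near_serre)
      have coeff: "q p p * q j p / kappa k j = 1 / kappa (Suc k) j"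
        using near_product[OF pj dist short] nz unfolding kp by (simp add: field_simps)
      have "qad (e p) (kappa k p * q p p * q j p) (root_poly m) \<in> I"
        unfolding target coeff[symmetric]
        by (rule serre_square_exchange[OF carr(5,4,1) nz(1,2,3) X fY gU g])
      then show ?thesis
        by (simp only: kp previous)
    qed
  qed
qed

lemma qtwist_root_poly: "qtwist q i (root_poly m) = left_char m i *\<^sub>C root_poly m"
  by (induction m)
    (simp_all add: qtwist_const qtwist_diff qtwist_mult qtwist_scale qtwist_var char_Suc
      scale_diff_right mult_ac)

text \<open>The derivation for the preceding letter takes $X^m$ to a multiple of $X^{m-1}$, and the bracket
coefficient is such that the result of differentiating $X^{m+1}$ is the q-commutator of $X^{m-1}$ with
the new letter, which lies in the ideal. For the new letter itself the coefficient is
$\chi(1 - q_{jj})$ with $\chi$ the value of the bicharacter.\<close>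

lemma qderiv_root_poly:
  assumes "m \<le> 2 * l - 1"
  shows "(\<forall>i\<in>{1..l}. i \<noteq> letter m \<longrightarrow> qderiv q i (root_poly m) \<in> I) \<and>
    (\<forall>n. m = Suc n \<longrightarrow> (\<exists>c. c \<noteq> 0 \<and>
       qderiv q (letter m) (root_poly m) - c *\<^sub>C root_poly n \<in> I))"
  using assms
proof (induction m)
  case 0
  have "qderiv q i (nc_const c) = 0" for i c
    using qderiv_scale[of q i c 1] by simp
  then show ?case
    by simp
next
  case (Suc m)
  define j where "j = letter (Suc m)"
  have j: "j \<in> {1..l}"
    using letter_range[of "Suc m"] Suc.prems by (auto simp: j_def)
  have jm: "j \<noteq> letter m"
  proof -
    have "m < 2 * l"
      using Suc.prems rank by linarith
    then show ?thesis
      using letter_distinct[of m] by (simp add: j_def)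
  qed
  have IH1: "qderiv q i (root_poly m) \<in> I" if "i \<in> {1..l}" "i \<noteq> letter m" for i
    using Suc that by simp
  have carr: "root_poly m \<in> A" "e j \<in> A"
    using root_poly_carrier Suc.prems j e_carrier by auto
  have D: "qderiv q i (root_poly (Suc m)) =
     (qderiv q i (root_poly m) * e j - (q i j / kappa m j) *\<^sub>C (e j * qderiv q i (root_poly m)))
     + (if i = j then left_char m j - 1 / kappa m j else 0) *\<^sub>C root_poly m" for i
    unfolding root_poly.simps j_def[symmetric]
    by (simp add: qderiv_diff qderiv_cscale qderiv_mult qderiv_var qtwist_root_poly qtwist_var
        scale_simps algebra_simps)
  have main: "qderiv q i (root_poly m) * e j - (q i j / kappa m j) *\<^sub>C (e j * qderiv q i (root_poly m)) \<in> I"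
    if i: "i \<in> {1..l}" for i
  proof (cases "i = letter m")
    case False
    then show ?thesis
      using IH1[OF i] carr by (simp add: I_diff I_scale I_lmult I_rmult)
  next
    case True
    then obtain n where m: "m = Suc n"
      using i by (cases m) auto
    obtain c where c: "qderiv q i (root_poly m) - c *\<^sub>C root_poly n \<in> I" (is "?r \<in> I")
      using Suc True m by auto
    have jk: "kappa n j \<noteq> 0" "kappa m j = kappa n j * q i j" "q i j \<noteq> 0"
      using kappa_nonzero[of n j] Suc.prems j i m True q_nonzero[OF i j] by (auto simp: kappa_Suc)
    have "qad (e j) (kappa n j) (root_poly n) \<in> I"
      using Suc.prems m j jm by (intro root_poly_commute) auto
    then have "(- c / kappa n j) *\<^sub>C qad (e j) (kappa n j) (root_poly n) \<in> I"
      by (rule I_scale)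
    moreover have "?r * e j - (q i j / kappa m j) *\<^sub>C (e j * ?r) \<in> I"
      using c carr by (simp only: I_diff I_scale I_lmult I_rmult)
    ultimately have "(- c / kappa n j) *\<^sub>C qad (e j) (kappa n j) (root_poly n)
       + (?r * e j - (q i j / kappa m j) *\<^sub>C (e j * ?r)) \<in> I"
      by (rule I_add)
    also have "(- c / kappa n j) *\<^sub>C qad (e j) (kappa n j) (root_poly n)
       + (?r * e j - (q i j / kappa m j) *\<^sub>C (e j * ?r))
       = qderiv q i (root_poly m) * e j - (q i j / kappa m j) *\<^sub>C (e j * qderiv q i (root_poly m))"
      using jk by (simp add: qad_def scale_diff_right left_diff_distrib right_diff_distrib scale_minus_left)
    finally show ?thesis .
  qed
  have "qderiv q i (root_poly (Suc m)) \<in> I" if "i \<in> {1..l}" "i \<noteq> j" for i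
    using main[OF that(1)] that(2) unfolding D by simp
  moreover have "qderiv q j (root_poly (Suc m)) - (left_char m j - 1 / kappa m j) *\<^sub>C root_poly m \<in> I"
    using main[OF j] unfolding D by simp
  moreover have "left_char m j - 1 / kappa m j \<noteq> 0"
  proof -
    have inv: "1 / kappa m j = left_char m j * q j j"
      using Suc.prems by (intro inverse_kappa) (auto simp: j_def)
    have "kappa m j \<noteq> 0"
      using kappa_nonzero[of m j] Suc.prems j by auto
    then have "left_char m j \<noteq> 0"
      using inv by auto
    then show ?thesis
      unfolding inv using diag_neq_1[OF j] by simp
  qed
  ultimately show ?case
    unfolding j_def by blast
qed

lemma root_poly_notin_ideal: "m \<le> 2 * l - 1 \<Longrightarrow> root_poly m \<notin> I"
proof (induction m)
  case 0
  then show ?case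
    using q11_neq_1 by (simp add: nc_const_notin_q_ideal)
next
  case (Suc m)
  show ?case
  proof
    assume "root_poly (Suc m) \<in> I"
    then have d: "qderiv q (letter (Suc m)) (root_poly (Suc m)) \<in> I"
      using letter_range Suc.prems by (intro qderiv_q_ideal) auto
    obtain c where "c \<noteq> 0"
      and c: "qderiv q (letter (Suc m)) (root_poly (Suc m)) - c *\<^sub>C root_poly m \<in> I"
      using qderiv_root_poly[OF Suc.prems] by blast
    have "c *\<^sub>C root_poly m \<in> I"
      using I_diff[OF d c] by simp
    then have "root_poly m \<in> I"
      using \<open>c \<noteq> 0\<close> by (rule I_unscale)
    then show False
      using Suc by simp
  qed
qed

text \<open>A letter \<open>i < l\<close> occurs in the steps \<open>i\<close> and \<open>2 * l - i\<close>, the letter \<open>l\<close> only in step \<open>l\<close>.\<close>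

lemma root_poly_weight:
  assumes "m \<le> 2 * l - 1" "w \<in> Poly_Mapping.keys (root_poly m)" "i \<in> {1..l}"
  shows "count_list w i = (if i \<le> m then 1 else 0) + (if i < l \<and> 2 * l - i \<le> m then 1 else 0)"
  using assms(1,2)
proof (induction m arbitrary: w)
  case 0
  then show ?case
    using assms(3) by (auto simp: nc_const_def split: if_splits)
next
  case (Suc m)
  define j where "j = letter (Suc m)"
  have "w \<in> Poly_Mapping.keys (root_poly m * e j) \<union> Poly_Mapping.keys (e j * root_poly m)"
    using Suc.prems(2) unfolding root_poly.simps j_def[symmetric]
    by (auto simp: in_keys_iff lookup_minus lookup_scale)
  then have "\<exists>v\<in>Poly_Mapping.keys (root_poly m). w = v @ [j] \<or> w = [j] @ v"
    by (auto simp: nc_var_def elim!: keys_mult_append)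
  then obtain v where v: "v \<in> Poly_Mapping.keys (root_poly m)" "w = v @ [j] \<or> w = [j] @ v"
    by blast
  have "count_list w i = count_list v i + (if i = j then 1 else 0)"
    using v(2) by auto
  then show ?case
    using Suc.IH[OF _ v(1)] Suc.prems(1) assms(3) by (auto simp: j_def letter_def)
qed

section \<open>The prescribed bracket coefficients and the highest root vector\<close>

text \<open>The step \<open>l + k\<close> contributes the letter \<open>l - k\<close>, so the descending part of the product runs over
\<open>{l - n..l - 1}\<close>, which is the second product in $b_n$.\<close>

lemma left_char_descent:
  "n < l \<Longrightarrow> left_char (l + n) i = (\<Prod>k=1..l. q i k) * (\<Prod>k=l-n..l-1. q i k)"
proof (induction n)
  case 0
  have "left_char l i = (\<Prod>k=1..l. q i k)"
    unfolding left_char_def by (rule prod.cong) (auto simp: letter_def)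
  then show ?case
    using rank by simp
next
  case (Suc n)
  have "{l - Suc n..l - 1} = insert (l - Suc n) {l - n..l - 1}"
    using Suc.prems by auto
  moreover have "letter (Suc (l + n)) = l - Suc n"
    using Suc.prems by (simp add: letter_def)
  moreover have "l - Suc n \<notin> {l - n..l - 1}"
    using Suc.prems by auto
  ultimately show ?case
    using Suc by (simp add: char_Suc mult_ac)
qed

lemma b_coeff_eq:
  assumes "1 \<le> n" "n \<le> l - 1"
  shows "b_coeff q l n = 1 / kappa (l + n - 1) (l - n)"
proof -
  have j: "letter (l + n) = l - n"
    using assms by (simp add: letter_def)
  have "1 / kappa (l + n - 1) (l - n) = left_char (l + n - 1) (l - n) * q (l - n) (l - n)"
    using assms rank j by (intro inverse_kappa) auto
  also have "\<dots> = left_char (l + n) (l - n)"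
    using char_Suc(1)[of "l + n - 1" "l - n"] assms j by simp
  finally show ?thesis
    using left_char_descent[of n "l - n"] assms by (simp add: b_coeff_def)
qed

lemma a_coeff_eq:
  assumes "2 \<le> n" "n \<le> l"
  shows "a_coeff q n = 1 / kappa (n - 1) n"
proof -
  obtain k where k: "n = Suc (Suc k)"
    using that[of "n - 2"] assms(1) by simp
  have L: "left_char k n = (\<Prod>k=1..n-2. q n k)"
    unfolding left_char_def using assms by (intro prod.cong) (auto simp: letter_def k)
  have "left_char k n * right_char k n = 1"
    using char_product[of k n] assms by (auto simp: letter_def k first_factor_def)
  then have "left_char k n = 1 / right_char k n"
    by (metis eq_divide_eq mult_zero_right zero_neq_one)
  moreover have "kappa (n - 1) n = right_char k n * q (n - 1) n"
    using assms by (auto simp: kappa_def first_factor_def k char_Suc letter_def)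
  moreover have "q (n - 1) n \<noteq> 0"
    using assms by (intro q_nonzero) auto
  ultimately have "1 / kappa (n - 1) n = left_char k n / q (n - 1) n"
    by simp
  then show ?thesis
    by (simp add: a_coeff_def L)
qed

lemma X_elem_eq:
  "1 \<le> m \<Longrightarrow> m \<le> 2 * l - 1 \<Longrightarrow> X_elem q l m = q_proj q l (root_poly m)"
proof (induction m)
  case (Suc m)
  show ?case
  proof (cases "m = 0")
    case True
    then show ?thesis
      by (simp add: q_gen_def root_poly_1 del: root_poly.simps)
  next
    case False
    let ?j = "letter (Suc m)"
    have carr: "root_poly m \<in> A" "e ?j \<in> A"
      using root_poly_carrier Suc.prems letter_range[of "Suc m"] e_carrier by auto
    have IH: "X_elem q l m = q_proj q l (root_poly m)"
      using Suc False by simp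
    have "X_elem q l (Suc m) = q_bracket q l (1 / kappa m ?j) (X_elem q l m) (q_gen q l ?j)"
    proof (cases "Suc m \<le> l")
      case True
      then show ?thesis
        using False a_coeff_eq[of "Suc m"] by (simp add: letter_def)
    next
      case f: False
      then have "b_coeff q l (Suc m - l) = 1 / kappa m (l - (Suc m - l))"
        using b_coeff_eq[of "Suc m - l"] Suc.prems by simp
      moreover have "letter (Suc m) = l - (Suc m - l)"
        using f Suc.prems by (simp add: letter_def)
      ultimately show ?thesis
        using f False by simp
    qed
    then show ?thesis
      using carr by (simp add: IH q_gen_def q_bracket_proj)
  qed
qed simp

lemma root_poly_highest: "C_highest_root_vector q l (q_proj q l (root_poly (2 * l - 1)))"
proof -
  let ?X = "root_poly (2 * l - 1)"
  have XA: "?X \<in> A"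
    by (rule root_poly_carrier) simp
  have "?X \<in> weight_space l (C_highest_root l)"
    unfolding weight_space_def
  proof (intro CollectI conjI ballI XA)
    fix w i assume "w \<in> Poly_Mapping.keys ?X" "i \<in> {1..l}"
    then show "count_list w i = C_highest_root l i"
      using root_poly_weight[of "2 * l - 1" w i] by (auto simp: C_highest_root_def)
  qed
  moreover have "q_bracket q l (kappa (2 * l - 1) i) (q_gen q l i) (q_proj q l ?X) = \<zero>\<^bsub>q_quot q l\<^esub>"
    if i: "i \<in> {1..l}" for i
  proof -
    have "qad (e i) (kappa (2 * l - 1) i) ?X \<in> I"
      using i letter_end rank by (intro root_poly_commute) auto
    then show ?thesis
      using i XA by (simp add: q_gen_def q_bracket_proj e_carrier q_proj_zero_iff I_subset
          flip: qad_def)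
  qed
  moreover have "q_proj q l ?X \<noteq> \<zero>\<^bsub>q_quot q l\<^esub>"
    using root_poly_notin_ideal XA by (simp add: q_proj_zero_iff)
  ultimately show ?thesis
    unfolding C_highest_root_vector_def q_weight_space_def by blast
qed

end

theorem corollary2p4p12:
  fixes l :: nat and q :: "nat \<Rightarrow> nat \<Rightarrow> complex"
  assumes "l \<ge> 2"
    and "C_constraints q l"
    and "C_general_position q l"
  shows "C_highest_root_vector q l (X_elem q l (2 * l - 1))"
proof -
  interpret C_parameters l q
    by unfold_locales fact+
  show ?thesis
    using root_poly_highest assms(1) by (simp add: X_elem_eq)
qed

end
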